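(* Let $n\in\mathbb N$, let $\Phi\in\mathsf{CPTP}(n)$, and let $x,x^\perp\in\mathbb C^n$ be orthogonal unit vectors. Consider the following two statements: (i) $\Phi(|x^\perp\rangle\langle x^\perp|)\,G\,|x\rangle=0$ and $\Phi(|x\rangle\langle x|)\,G\,|x\rangle=0$ for all $G\in\mathcal K_\Phi^\perp$. (ii) $\langle x^\perp|K_j^\dagger G_k|x\rangle=0=\langle x|K_j^\dagger G_k|x\rangle$ for all $j,k$, where $\{K_j\}_j$ is any set of Kraus operators of $\Phi$ and $\{G_k\}_k$ is any basis of $\mathcal K_\Phi^\perp$. Then (i) and (ii) are equivalent. Moreover, if they hold, then there exists $\lambda\in(0,1)$ such that $\Phi\Psi_\lambda^{-1}$ is completely positive, where $\Psi_\lambda:=\Psi_{\lambda,x,x^\perp}$; in particular, $\Phi=(\Phi\Psi_\lambda^{-1})\Psi_\lambda$ is divisible. If, in addition to (i)/(ii), $\Phi(|x\rangle\langle x|)\neq\Phi(|x^\perp\rangle\langle x^\perp|)$, then there exists $\lambda\in(0,1)$ such that $\Phi\Psi_\lambda^{-1}$ is completely positive and its Kraus rank is strictly smaller than the Kraus rank of $\Phi$.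
   Context: $\mathsf{CPTP}(n)$ denotes the set of completely positive, trace-preserving linear maps $\mathbb C^{n\times n}\to\mathbb C^{n\times n}$ (quantum channels). Products of maps denote composition. Inner products are linear in the second argument and $|u\rangle\langle v|=uv^\dagger$. Kraus operators of a completely positive map $\Phi$ are matrices $\{K_j\}_{j=1}^\ell\subset\mathbb C^{n\times n}$ (a finite family) with $\Phi(X)=\sum_j K_jXK_j^\dagger$ for all $X$. The Kraus subspace is $\mathcal K_\Phi:=\mathrm{span}\{K_1,\dots,K_\ell\}$; it does not depend on the choice of Kraus operators. $\mathcal K_\Phi^\perp$ is its orthogonal complement in $\mathbb C^{n\times n}$ with respect to the Hilbert–Schmidt inner product $\langle A,B\rangle_{\rm HS}=\mathrm{tr}(A^\dagger B)$. The Choi matrix is $\mathsf C(\Phi)=\sum_{j,k=1}^n|j\rangle\langle k|\otimes\Phi(|j\rangle\langle k|)$, with $|j\rangle$ the standard basis, and the Kraus rank of $\Phi$ is $\mathrm{rank}(\mathsf C(\Phi))$. A channel $\Phi\in\mathsf{CPTP}(n)$ is called divisible if there exist $\Phi_1,\Phi_2\in\mathsf{CPTP}(n)$ with $\Phi=\Phi_1\Phi_2$ such that either neither or both of $\Phi_1,\Phi_2$ are unitary channels, i.e. of the form $U(\cdot)U^\dagger$ with $U\in\mathbb C^{n\times n}$ unitary. For linearly independent unit vectors $x,y\in\mathbb C^n$ and $\lambda\in[0,1]$ define $K_\lambda:=\mathbf 1-(1-\sqrt{1-\lambda})|x\rangle\langle x|$, $L_\lambda:=\sqrt\lambda\,|y\rangle\langle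 x|$ and the channel $\Psi_{\lambda,x,y}(\rho):=K_\lambda\rho K_\lambda^\dagger+L_\lambda\rho L_\lambda^\dagger$. For $\lambda\in[0,1)$ the linear map $\Psi_{\lambda,x,y}$ is bijective on $\mathbb C^{n\times n}$, and $\Psi_{\lambda,x,y}^{-1}$ denotes its inverse. *)

theory Defs
  imports "HOL-Analysis.Analysis"
begin

text \<open>
  An \<open>n \<times> n\<close> matrix is an element of \<open>complex^'n^'n\<close> for a finite index type \<open>'n\<close>.
  The library's \<open>real_vector\<close> structure on this type is not the complex one, so
  \<open>cmat.span\<close>, \<open>cmat.independent\<close>, etc. below refer to the explicit complex scaling
  \<open>cmat_scale\<close>. Likewise \<open>(\<bullet>)\<close> is only the real part of the complex inner product.
\<close>

type_synonym 'n cmat = "complex^'n^'n"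

definition cmat_scale :: "complex \<Rightarrow> 'n::finite cmat \<Rightarrow> 'n cmat"
  where "cmat_scale c A = (\<chi> i j. c * A $ i $ j)"

interpretation cmat: vector_space cmat_scale
  by unfold_locales (simp_all add: cmat_scale_def vec_eq_iff algebra_simps)

definition dagger :: "'n::finite cmat \<Rightarrow> 'n cmat"
  where "dagger A = (\<chi> i j. cnj (A $ j $ i))"

definition cinner :: "complex^'n::finite \<Rightarrow> complex^'n \<Rightarrow> complex"
  where "cinner u v = (\<Sum>i\<in>UNIV. cnj (u $ i) * v $ i)"

definition ketbra :: "complex^'n::finite \<Rightarrow> complex^'n \<Rightarrow> 'n cmat"
  where "ketbra u v = (\<chi> i j. u $ i * cnj (v $ j))"

definition hs_inner :: "'n::finite cmat \<Rightarrow> 'n cmat \<Rightarrow> complex"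
  where "hs_inner A B = trace (dagger A ** B)"

definition hs_orthogonal :: "'n::finite cmat set \<Rightarrow> 'n cmat set"
  where "hs_orthogonal S = {G. \<forall>A\<in>S. hs_inner A G = 0}"

definition is_cmat_basis :: "'n::finite cmat set \<Rightarrow> 'n cmat set \<Rightarrow> bool"
  where "is_cmat_basis B S \<longleftrightarrow> cmat.independent B \<and> cmat.span B = S"

definition unitary :: "'n::finite cmat \<Rightarrow> bool"
  where "unitary U \<longleftrightarrow> dagger U ** U = mat 1 \<and> U ** dagger U = mat 1"

definition kron :: "'m::finite cmat \<Rightarrow> 'n::finite cmat \<Rightarrow> ('m \<times> 'n) cmat"
  where "kron A B = (\<chi> p q. A $ fst p $ fst q * B $ snd p $ snd q)"

text \<open>
  An element of \<open>\<complex>\<^sup>m\<^sup>\<times>\<^sup>m \<otimes> \<complex>\<^sup>n\<^sup>\<times>\<^sup>n\<close> is represented by its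
  \<open>m \<times> m\<close> array \<open>X\<close> of \<open>n \<times> n\<close> blocks, and a vector in \<open>\<complex>\<^sup>m \<otimes> \<complex>\<^sup>n\<close>
  by its \<open>m\<close> components in \<open>\<complex>\<^sup>n\<close>; only the entries with indices below \<open>m\<close> matter.
  In this representation \<open>id\<^sub>m \<otimes> \<Phi>\<close> acts by applying \<open>\<Phi>\<close> to every block.
\<close>

definition block_psd :: "nat \<Rightarrow> (nat \<Rightarrow> nat \<Rightarrow> 'n::finite cmat) \<Rightarrow> bool"
  where "block_psd m X \<longleftrightarrow>
    (\<forall>v :: nat \<Rightarrow> complex^'n. (\<Sum>a<m. \<Sum>b<m. cinner (v a) (X a b *v v b)) \<in> \<real>\<^sub>\<ge>\<^sub>0)"

definition completely_positive :: "('n::finite cmat \<Rightarrow> 'n cmat) \<Rightarrow> bool"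
  where "completely_positive \<Phi> \<longleftrightarrow>
    Vector_Spaces.linear cmat_scale cmat_scale \<Phi> \<and>
    (\<forall>m X. block_psd m X \<longrightarrow> block_psd m (\<lambda>a b. \<Phi> (X a b)))"

definition CPTP :: "('n::finite cmat \<Rightarrow> 'n cmat) set"
  where "CPTP = {\<Phi>. completely_positive \<Phi> \<and> (\<forall>X. trace (\<Phi> X) = trace X)}"

definition unitary_channel :: "('n::finite cmat \<Rightarrow> 'n cmat) \<Rightarrow> bool"
  where "unitary_channel \<Phi> \<longleftrightarrow> (\<exists>U. unitary U \<and> \<Phi> = (\<lambda>X. U ** X ** dagger U))"

definition channel_division ::
    "('n::finite cmat \<Rightarrow> 'n cmat) \<Rightarrow> ('n cmat \<Rightarrow> 'n cmat) \<Rightarrow> ('n cmat \<Rightarrow> 'n cmat) \<Rightarrow> bool"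
  where "channel_division \<Phi> \<Phi>1 \<Phi>2 \<longleftrightarrow>
    \<Phi>1 \<in> CPTP \<and> \<Phi>2 \<in> CPTP \<and> \<Phi> = \<Phi>1 \<circ> \<Phi>2 \<and> (unitary_channel \<Phi>1 \<longleftrightarrow> unitary_channel \<Phi>2)"

definition divisible :: "('n::finite cmat \<Rightarrow> 'n cmat) \<Rightarrow> bool"
  where "divisible \<Phi> \<longleftrightarrow> \<Phi> \<in> CPTP \<and> (\<exists>\<Phi>1 \<Phi>2. channel_division \<Phi> \<Phi>1 \<Phi>2)"

definition kraus_ops :: "('n::finite cmat \<Rightarrow> 'n cmat) \<Rightarrow> 'n cmat list \<Rightarrow> bool"
  where "kraus_ops \<Phi> Ks \<longleftrightarrow> (\<forall>X. \<Phi> X = (\<Sum>K\<leftarrow>Ks. K ** X ** dagger K))"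

text \<open>
  The description is meaningful for completely positive \<open>\<Phi>\<close>: these have Kraus operators, and
  all choices of them have the same span.
\<close>

definition kraus_subspace :: "('n::finite cmat \<Rightarrow> 'n cmat) \<Rightarrow> 'n cmat set"
  where "kraus_subspace \<Phi> = (THE S. \<exists>Ks. kraus_ops \<Phi> Ks \<and> S = cmat.span (set Ks))"

definition choi :: "('n::finite cmat \<Rightarrow> 'n cmat) \<Rightarrow> ('n \<times> 'n) cmat"
  where "choi \<Phi> = (\<Sum>j\<in>UNIV. \<Sum>k\<in>UNIV.
    kron (ketbra (axis j 1) (axis k 1)) (\<Phi> (ketbra (axis j 1) (axis k 1))))"

definition kraus_rank :: "('n::finite cmat \<Rightarrow> 'n cmat) \<Rightarrow> nat"
  where "kraus_rank \<Phi> = rank (choi \<Phi>)"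

definition psi_K :: "real \<Rightarrow> complex^'n::finite \<Rightarrow> 'n cmat"
  where "psi_K l x = mat 1 - (1 - sqrt (1 - l)) *\<^sub>R ketbra x x"

definition psi_L :: "real \<Rightarrow> complex^'n::finite \<Rightarrow> complex^'n \<Rightarrow> 'n cmat"
  where "psi_L l x y = sqrt l *\<^sub>R ketbra y x"

definition psi :: "real \<Rightarrow> complex^'n::finite \<Rightarrow> complex^'n \<Rightarrow> 'n cmat \<Rightarrow> 'n cmat"
  where "psi l x y \<rho> =
    psi_K l x ** \<rho> ** dagger (psi_K l x) + psi_L l x y ** \<rho> ** dagger (psi_L l x y)"

definition image_condition ::
    "('n::finite cmat \<Rightarrow> 'n cmat) \<Rightarrow> complex^'n \<Rightarrow> complex^'n \<Rightarrow> bool"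
  where "image_condition \<Phi> x x' \<longleftrightarrow>
    (\<forall>G\<in>hs_orthogonal (kraus_subspace \<Phi>).
      (\<Phi> (ketbra x' x') ** G) *v x = 0 \<and> (\<Phi> (ketbra x x) ** G) *v x = 0)"

definition kraus_condition ::
    "'n::finite cmat list \<Rightarrow> 'n cmat set \<Rightarrow> complex^'n \<Rightarrow> complex^'n \<Rightarrow> bool"
  where "kraus_condition Ks B x x' \<longleftrightarrow>
    (\<forall>K\<in>set Ks. \<forall>G\<in>B.
      cinner x' ((dagger K ** G) *v x) = 0 \<and> cinner x ((dagger K ** G) *v x) = 0)"

end

theory Submission
  imports Defs
begin

text \<open>
  Let \<open>E = |y\<rangle>\<langle>x|\<close> with \<open>y = x\<^sup>\<bottom>\<close>, let \<open>K\<^sub>j\<close> be Kraus operators of \<open>\<Phi>\<close>, and put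
  \<open>D(B) = \<Sum>\<^sub>j |\<langle>K\<^sub>j, B\<rangle>|\<^sup>2\<close> and \<open>N(B) = \<Sum>\<^sub>j |\<langle>K\<^sub>j E, B\<rangle>|\<^sup>2\<close>.
  The inverse of \<open>\<Psi>\<^sub>\<lambda>\<close> is \<open>\<sigma> \<mapsto> J \<sigma> J - \<lambda>/(1-\<lambda>) E \<sigma> E\<^sup>\<dagger>\<close> with \<open>J\<close> the inverse of
  \<open>K\<^sub>\<lambda>\<close>, and so the quadratic form of the Choi matrix of \<open>\<Phi> \<Psi>\<^sub>\<lambda>\<^sup>-\<^sup>1\<close> at \<open>B K\<^sub>\<lambda>\<close> is
  \<open>D(B) - \<lambda> N(B)\<close>. Condition (ii) makes the Kraus subspace invariant under right multiplication
  by \<open>E\<close>, so \<open>N\<close> vanishes where \<open>D\<close> does, and by compactness there is a least \<open>C\<close> with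
  \<open>N \<le> C D\<close>. Complete positivity therefore holds whenever \<open>\<lambda> < 1\<close> and
  \<open>\<lambda> C \<le> 1\<close>. If \<open>\<lambda> = 1/C\<close>, the form has
  a further kernel vector, which lowers the rank. Finally \<open>C > 1\<close> unless
  \<open>\<Phi>(|y\<rangle>\<langle>y|) \<le> \<Phi>(|x\<rangle>\<langle>x|)\<close>, and since both have trace one this means equality.
\<close>

subsection \<open>Matrix algebra\<close>

lemma cinner_add_right: "cinner u (v + w) = cinner u v + cinner u w"
  by (simp add: cinner_def algebra_simps sum.distrib)

lemma cinner_add_left: "cinner (u + v) w = cinner u w + cinner v w"
  by (simp add: cinner_def algebra_simps sum.distrib)

lemma cinner_diff_right: "cinner u (v - w) = cinner u v - cinner u w"
  by (simp add: cinner_def algebra_simps sum_subtractf)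

lemma cinner_diff_left: "cinner (u - v) w = cinner u w - cinner v w"
  by (simp add: cinner_def algebra_simps sum_subtractf)

lemma cinner_zero_left [simp]: "cinner 0 v = 0"
  by (simp add: cinner_def)

lemma cinner_zero_right [simp]: "cinner u 0 = 0"
  by (simp add: cinner_def)

lemma cinner_scale_right: "cinner u (c *s v) = c * cinner u v"
  by (simp add: cinner_def sum_distrib_left algebra_simps)

lemma cinner_scale_left: "cinner (c *s u) v = cnj c * cinner u v"
  by (simp add: cinner_def sum_distrib_left algebra_simps)

lemma cinner_scaleR_right: "cinner u (c *\<^sub>R v) = of_real c * cinner u v"
  by (simp add: cinner_def sum_distrib_left) (simp add: scaleR_conv_of_real algebra_simps)

lemma cinner_sum_list_right: "cinner u (\<Sum>x\<leftarrow>xs. f x) = (\<Sum>x\<leftarrow>xs. cinner u (f x))"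
  by (induction xs) (simp_all add: cinner_add_right)

lemma cnj_cinner: "cnj (cinner u v) = cinner v u"
  by (simp add: cinner_def mult.commute)

lemma cinner_eq_0_commute: "cinner u v = 0 \<longleftrightarrow> cinner v u = 0"
  using cnj_cinner[of u v] cnj_cinner[of v u] by auto

lemma inner_eq_Re_cinner: "u \<bullet> v = Re (cinner u v)"
  by (simp add: inner_vec_def cinner_def inner_complex_def)

lemma cinner_self: "cinner v v = of_real ((norm v)\<^sup>2)"
proof -
  have "Im (cinner v v) = 0"
    using cnj_cinner[of v v] by (simp add: complex_eq_iff)
  moreover have "Re (cinner v v) = (norm v)\<^sup>2"
    by (simp add: inner_eq_Re_cinner[symmetric] power2_norm_eq_inner)
  ultimately show ?thesis by (simp add: complex_eq_iff)
qed

lemma cinner_mult_vec_right: "cinner u (A *v v) = cinner (dagger A *v u) v"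
  by (simp add: cinner_def dagger_def matrix_vector_mult_def sum_distrib_left sum_distrib_right)
     (subst sum.swap, simp add: algebra_simps)

lemma cinner_axis_left: "cinner (axis i 1) v = v $ i"
proof -
  have "cinner (axis i 1) v = (\<Sum>j\<in>UNIV. if j = i then v $ j else 0)"
    unfolding cinner_def by (rule sum.cong) (auto simp: axis_def)
  then show ?thesis by simp
qed

lemma cinner_axis_right: "cinner v (axis i 1) = cnj (v $ i)"
  using cnj_cinner[of "axis i 1" v] by (simp add: cinner_axis_left)

lemma mult_vec_axis: "(A *v axis j 1) $ i = (A :: complex^'n^'m) $ i $ j"
proof -
  have "(A *v axis j 1) $ i = (\<Sum>k\<in>UNIV. if k = j then A $ i $ k else 0)"
    unfolding matrix_vector_mult_def vec_lambda_beta
    by (rule sum.cong) (auto simp: axis_def)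
  then show ?thesis by simp
qed

lemma mult_vec_scale: "A *v (c *s v) = c *s (A *v v)" for A :: "complex^'n^'m"
  by (simp add: matrix_vector_mult_def vec_eq_iff sum_distrib_left algebra_simps)

lemma dagger_dagger [simp]: "dagger (dagger A) = A"
  by (simp add: dagger_def vec_eq_iff)

lemma dagger_mult: "dagger (A ** B) = dagger B ** dagger A"
  by (simp add: dagger_def matrix_matrix_mult_def vec_eq_iff mult.commute)

lemma dagger_diff: "dagger (A - B) = dagger A - dagger B"
  by (simp add: dagger_def vec_eq_iff)

lemma dagger_scaleR: "dagger (c *\<^sub>R A) = c *\<^sub>R dagger A"
  by (simp add: dagger_def vec_eq_iff)

lemma dagger_mat_1 [simp]: "dagger (mat 1) = mat 1"
  by (auto simp: dagger_def vec_eq_iff mat_def)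

lemma dagger_ketbra: "dagger (ketbra u v) = ketbra v u"
  by (simp add: dagger_def ketbra_def vec_eq_iff)

lemma cmat_add_rdistrib: "(A + B) ** C = A ** C + B ** C" for A :: "complex^'n^'m"
  by (simp add: matrix_matrix_mult_def vec_eq_iff algebra_simps sum.distrib)

lemma cmat_diff_ldistrib: "A ** (B - C) = A ** B - A ** C" for A :: "complex^'n^'m"
  by (simp add: matrix_matrix_mult_def vec_eq_iff algebra_simps sum_subtractf)

lemma cmat_diff_rdistrib: "(A - B) ** C = A ** C - B ** C" for A :: "complex^'n^'m"
  by (simp add: matrix_matrix_mult_def vec_eq_iff algebra_simps sum_subtractf)

lemma cmat_scaleR_left: "(c *\<^sub>R A) ** B = c *\<^sub>R (A ** B)" for A :: "complex^'n^'m"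
  by (simp add: matrix_matrix_mult_def vec_eq_iff scaleR_sum_right)

lemma cmat_scaleR_right: "A ** (c *\<^sub>R B) = c *\<^sub>R (A ** B)" for A :: "complex^'n^'m"
  by (simp add: matrix_matrix_mult_def vec_eq_iff scaleR_sum_right)

lemma cmat_scaleR_mult_vec: "(c *\<^sub>R A) *v v = c *\<^sub>R (A *v v)" for A :: "complex^'n^'m"
  by (simp add: matrix_vector_mult_def vec_eq_iff scaleR_sum_right)

lemmas cmat_distribs = matrix_add_ldistrib cmat_add_rdistrib cmat_diff_ldistrib
  cmat_diff_rdistrib cmat_scaleR_left cmat_scaleR_right

lemma sum_list_mult_vec: "(\<Sum>x\<leftarrow>xs. f x) *v v = (\<Sum>x\<leftarrow>xs. f x *v v)"
  for f :: "'a \<Rightarrow> complex^'n^'m"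
  by (induction xs) (simp_all add: matrix_vector_mult_add_rdistrib)

lemma sum_list_nth: "(\<Sum>x\<leftarrow>xs. f x) $ i = (\<Sum>x\<leftarrow>xs. f x $ i)"
  by (induction xs) simp_all

lemma ketbra_mult_vec: "ketbra u v *v w = cinner v w *s u"
  by (simp add: ketbra_def matrix_vector_mult_def cinner_def vec_eq_iff mult_ac
      flip: sum_distrib_left)

lemma mult_ketbra: "A ** ketbra u v = ketbra (A *v u) v"
  by (simp add: ketbra_def matrix_vector_mult_def matrix_matrix_mult_def vec_eq_iff
      sum_distrib_left mult_ac)

lemma ketbra_mult: "ketbra u v ** A = ketbra u (dagger A *v v)"
  by (simp add: ketbra_def matrix_vector_mult_def matrix_matrix_mult_def vec_eq_iff dagger_def
      sum_distrib_left algebra_simps)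

lemma ketbra_scale_left: "ketbra (c *s u) v = cmat_scale c (ketbra u v)"
  by (simp add: ketbra_def cmat_scale_def vec_eq_iff)

lemma ketbra_mult_ketbra: "ketbra a b ** ketbra c d = cmat_scale (cinner b c) (ketbra a d)"
  by (simp add: mult_ketbra ketbra_mult_vec ketbra_scale_left)

lemma cmat_scale_of_real: "cmat_scale (of_real c) A = c *\<^sub>R A"
  by (simp add: cmat_scale_def vec_eq_iff) (simp add: scaleR_conv_of_real)

lemma trace_eq_sum: "trace A = (\<Sum>i\<in>UNIV. A $ i $ i)"
  by (simp add: trace_def)

lemma trace_ketbra: "trace (ketbra u v) = cinner v u"
  by (simp add: trace_eq_sum ketbra_def cinner_def mult.commute)

lemma trace_cyclic: "trace (A ** B) = trace (B ** A)" for A :: "complex^'n^'n"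
  by (simp add: trace_eq_sum matrix_matrix_mult_def) (subst sum.swap, simp add: mult.commute)

lemma trace_cmat_add: "trace (A + B) = trace A + trace B" for A :: "complex^'n^'n"
  by (simp add: trace_eq_sum sum.distrib)

lemma trace_cmat_diff: "trace (A - B) = trace A - trace B" for A :: "complex^'n^'n"
  by (simp add: trace_eq_sum sum_subtractf)

lemma trace_sum_list: "trace (\<Sum>x\<leftarrow>xs. f x) = (\<Sum>x\<leftarrow>xs. trace (f x))"
  for f :: "'a \<Rightarrow> complex^'n^'n"
  by (induction xs) (simp_all add: trace_eq_sum sum.distrib)

text \<open>Index pairs are (column, row), so that \<open>choi\<close> of \<open>X \<mapsto> K X K\<^sup>\<dagger>\<close> is \<open>ketbra (mvec K) (mvec K)\<close>.\<close>

definition mvec :: "'n::finite cmat \<Rightarrow> complex^('n \<times> 'n)"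
  where "mvec A = (\<chi> p. A $ snd p $ fst p)"

definition unvec :: "complex^('n \<times> 'n) \<Rightarrow> 'n::finite cmat"
  where "unvec w = (\<chi> i j. w $ (j, i))"

lemma mvec_unvec [simp]: "mvec (unvec w) = w"
  by (simp add: mvec_def unvec_def vec_eq_iff)

lemma unvec_mvec [simp]: "unvec (mvec A) = A"
  by (simp add: mvec_def unvec_def vec_eq_iff)

lemma hs_inner_eq_sum: "hs_inner A B = (\<Sum>i\<in>UNIV. \<Sum>j\<in>UNIV. cnj (A $ i $ j) * B $ i $ j)"
  unfolding hs_inner_def trace_eq_sum matrix_matrix_mult_def dagger_def
  by simp (rule sum.swap)

lemma hs_inner_eq_cinner: "hs_inner A B = cinner (mvec A) (mvec B)"
  unfolding hs_inner_eq_sum cinner_def mvec_def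
  by (subst sum.swap) (simp add: sum.cartesian_product case_prod_beta)

lemma hs_inner_mult_left: "hs_inner (A ** B) C = hs_inner B (dagger A ** C)"
  by (simp add: hs_inner_def dagger_mult matrix_mul_assoc)

lemma hs_inner_mult_right: "hs_inner (A ** B) C = hs_inner A (C ** dagger B)"
  using trace_cyclic[of "dagger B" "dagger A ** C"]
  by (simp add: hs_inner_def dagger_mult matrix_mul_assoc)

lemma hs_inner_ketbra_right: "hs_inner A (ketbra u v) = cinner (A *v v) u"
  by (simp add: hs_inner_def mult_ketbra trace_ketbra cinner_mult_vec_right)

lemma cnj_hs_inner: "cnj (hs_inner A B) = hs_inner B A"
  by (simp add: hs_inner_eq_cinner cnj_cinner)

lemma inner_eq_Re_hs_inner: "A \<bullet> B = Re (hs_inner A B)" for A B :: "'n::finite cmat"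
  by (simp add: inner_vec_def hs_inner_eq_sum inner_complex_def)

lemma hs_inner_scale_left: "hs_inner (cmat_scale c A) B = cnj c * hs_inner A B"
  by (simp add: hs_inner_eq_sum cmat_scale_def sum_distrib_left algebra_simps)

lemma hs_inner_scale_right: "hs_inner A (cmat_scale c B) = c * hs_inner A B"
  by (simp add: hs_inner_eq_sum cmat_scale_def sum_distrib_left algebra_simps)

lemma hs_inner_scaleR_right: "hs_inner A (c *\<^sub>R B) = of_real c * hs_inner A B"
  by (metis hs_inner_scale_right cmat_scale_of_real)

lemma hs_inner_add_left: "hs_inner (A + B) C = hs_inner A C + hs_inner B C"
  by (simp add: hs_inner_eq_sum sum.distrib algebra_simps)

lemma hs_inner_add_right: "hs_inner A (B + C) = hs_inner A B + hs_inner A C"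
  by (simp add: hs_inner_eq_sum sum.distrib algebra_simps)

lemma hs_inner_diff_right: "hs_inner A (B - C) = hs_inner A B - hs_inner A C"
  by (simp add: hs_inner_eq_sum sum_subtractf algebra_simps)

lemma hs_inner_zero_left [simp]: "hs_inner 0 A = 0"
  by (simp add: hs_inner_eq_sum)

lemma hs_inner_zero_right [simp]: "hs_inner A 0 = 0"
  by (simp add: hs_inner_eq_sum)

subsection \<open>Positive semidefinite matrices\<close>

text \<open>Hermitian symmetry is a consequence: a complex form with only real values comes from a
  Hermitian matrix (\<open>psd_hermitian\<close>).\<close>

definition psd :: "complex^'n::finite^'n \<Rightarrow> bool"
  where "psd M \<longleftrightarrow> (\<forall>w. cinner w (M *v w) \<in> \<real>\<^sub>\<ge>\<^sub>0)"

lemma psd_Re: "psd M \<Longrightarrow> 0 \<le> Re (cinner w (M *v w))"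
  by (auto simp: psd_def complex_nonneg_Reals_iff)

lemma psd_Im: "psd M \<Longrightarrow> Im (cinner w (M *v w)) = 0"
  by (auto simp: psd_def complex_nonneg_Reals_iff)

text \<open>Polarization: suitable \<open>a\<close> and \<open>b\<close> isolate the off-diagonal
  entries of \<open>M\<close>.\<close>

lemma form_two_axes:
  fixes M :: "complex^'n::finite^'n"
  shows "cinner (a *s axis i 1 + b *s axis j 1) (M *v (a *s axis i 1 + b *s axis j 1)) =
    cnj a * a * M $ i $ i + cnj b * b * M $ j $ j + cnj a * b * M $ i $ j + cnj b * a * M $ j $ i"
  by (simp add: cinner_add_left cinner_add_right cinner_scale_left cinner_scale_right
      matrix_vector_right_distrib mult_vec_scale cinner_axis_left mult_vec_axis algebra_simps)

lemma psd_diag: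
  assumes "psd M"
  shows "0 \<le> Re (M $ i $ i)" "Im (M $ i $ i) = 0"
proof -
  have "cinner (axis i 1) (M *v axis i 1) = M $ i $ i"
    by (simp add: cinner_axis_left mult_vec_axis)
  then show "0 \<le> Re (M $ i $ i)" "Im (M $ i $ i) = 0"
    using psd_Re[OF assms, of "axis i 1"] psd_Im[OF assms, of "axis i 1"] by simp_all
qed

lemma psd_hermitian:
  assumes "psd M"
  shows "M $ j $ i = cnj (M $ i $ j)"
proof -
  \<comment> \<open>The coefficients 1, 1 control the imaginary part of the sum of the two entries;
    the coefficients 1, \<i> below control the real part of their difference.\<close>
  have "Im (M $ i $ j + M $ j $ i) = 0"
    using psd_Im[OF assms, of "1 *s axis i 1 + 1 *s axis j 1"] psd_diag[OF assms]
    unfolding form_two_axes by simp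
  moreover have "Re (M $ i $ j - M $ j $ i) = 0"
    using psd_Im[OF assms, of "1 *s axis i 1 + \<i> *s axis j 1"] psd_diag[OF assms]
    unfolding form_two_axes by simp
  ultimately show ?thesis by (simp add: complex_eq_iff)
qed

lemma psd_eq_zero:
  assumes psd: "psd M" and diag: "\<And>i. M $ i $ i = 0"
  shows "M = 0"
proof -
  have "M $ i $ j = 0" for i j
  proof -
    \<comment> \<open>With zero diagonal, this coefficient makes both cross terms equal to
      -|M_ij|^2, so the form is negative unless the entry vanishes.\<close>
    let ?b = "- cnj (M $ i $ j)"
    have "cinner (1 *s axis i 1 + ?b *s axis j 1) (M *v (1 *s axis i 1 + ?b *s axis j 1)) =
      - 2 * (M $ i $ j * cnj (M $ i $ j))"
      unfolding form_two_axes by (simp add: diag psd_hermitian[OF psd, where i = i and j = j])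
    then have "0 \<le> - 2 * (cmod (M $ i $ j))\<^sup>2"
      using psd_Re[OF psd, of "1 *s axis i 1 + ?b *s axis j 1"]
      by (simp add: complex_norm_square[symmetric] del: vector_smult_lid)
    then show ?thesis by simp
  qed
  then show ?thesis by (simp add: vec_eq_iff)
qed

lemma psd_dagger: "psd M \<Longrightarrow> dagger M = M"
  by (simp add: dagger_def vec_eq_iff psd_hermitian[symmetric])

text \<open>One step of the Cholesky decomposition, clearing the \<open>i\<close>-th row and column.\<close>

lemma psd_cholesky_step:
  fixes M :: "complex^'n::finite^'n"
  assumes psd: "psd M" and nz: "M $ i $ i \<noteq> 0"
  obtains v where "psd (M - ketbra v v)" "(M - ketbra v v) $ i $ i = 0"
proof -
  define m where "m = Re (M $ i $ i)"
  have m: "M $ i $ i = of_real m" using psd_diag[OF psd] by (simp add: m_def complex_eq_iff)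
  have "0 \<le> m" using psd_diag(1)[OF psd] by (simp add: m_def)
  moreover have "m \<noteq> 0" using nz m by auto
  ultimately have mpos: "m > 0" by simp
  \<comment> \<open>The normalised \<open>i\<close>-th column: then \<open>ketbra v v\<close> agrees
    with \<open>M\<close> on the whole \<open>i\<close>-th row and column.\<close>
  define v where "v = of_real (1 / sqrt m) *s (M *v axis i 1)"
  have vi: "cinner v w = of_real (1 / sqrt m) * (M *v w) $ i" for w
    unfolding v_def cinner_scale_left
    using cinner_mult_vec_right[of "axis i 1" M w] psd_dagger[OF psd]
    by (simp add: cinner_axis_left)
  have sq: "of_real (1 / sqrt m) * of_real (1 / sqrt m) = (of_real (1 / m) :: complex)"
    using mpos unfolding of_real_mult[symmetric] by simp
  have "cinner w ((M - ketbra v v) *v w) \<in> \<real>\<^sub>\<ge>\<^sub>0" for w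
  proof -
    define z where "z = (M *v w) $ i"
    \<comment> \<open>Completing the square: \<open>t\<close> minimises the form of \<open>M\<close>
      on the line through \<open>w\<close> in direction \<open>axis i 1\<close>, and the minimum is
      the form of \<open>M - ketbra v v\<close> at \<open>w\<close>.\<close>
    define t where "t = z / of_real m"
    let ?w = "w - t *s axis i 1"
    have "cinner (M *v axis i 1) w = z"
      using cinner_mult_vec_right[of "axis i 1" M w] psd_dagger[OF psd]
      by (simp add: cinner_axis_left z_def)
    then have z': "cinner w (M *v axis i 1) = cnj z"
      using cnj_cinner[of "M *v axis i 1" w] by simp
    have "cinner ?w (M *v ?w) = cinner w (M *v w) - cnj t * z - t * cnj z + cnj t * t * of_real m"
      by (simp add: cinner_diff_left cinner_diff_right cinner_scale_left cinner_scale_right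
          matrix_vector_mult_diff_distrib mult_vec_scale cinner_axis_left mult_vec_axis z'
          z_def[symmetric] m algebra_simps)
    also have "\<dots> = cinner w (M *v w) - z * cnj z / of_real m"
      using mpos by (simp add: t_def)
    also have "\<dots> = cinner w ((M - ketbra v v) *v w)"
    proof -
      have "cinner w (ketbra v v *v w) = cinner v w * cnj (cinner v w)"
        by (simp add: ketbra_mult_vec cinner_scale_right cnj_cinner)
      also have "\<dots> = (of_real (1 / sqrt m) * of_real (1 / sqrt m)) * (z * cnj z)"
        unfolding vi z_def[symmetric] by (simp del: of_real_divide)
      also have "\<dots> = z * cnj z / of_real m" unfolding sq by simp
      finally show ?thesis
        by (simp add: matrix_vector_mult_diff_rdistrib cinner_diff_right)
    qed
    finally show ?thesis using psd by (metis psd_def)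
  qed
  then have "psd (M - ketbra v v)" by (simp add: psd_def)
  moreover have "(M - ketbra v v) $ i $ i = 0"
  proof -
    have "v $ i = of_real (1 / sqrt m) * of_real m"
      by (simp add: v_def mult_vec_axis m)
    also have "\<dots> = of_real (sqrt m)"
      using mpos unfolding of_real_mult[symmetric] by (simp add: real_div_sqrt)
    finally have "ketbra v v $ i $ i = of_real (sqrt m * sqrt m)"
      by (simp add: ketbra_def del: real_sqrt_mult_self)
    then show ?thesis using m mpos by simp
  qed
  ultimately show ?thesis by (rule that)
qed

text \<open>Each Cholesky step clears one nonzero diagonal entry and creates none; once the diagonal
  is zero, so is the matrix (\<open>psd_eq_zero\<close>).\<close>

lemma psd_decomposition:
  fixes M :: "complex^'n::finite^'n"
  assumes "psd M"
  shows "\<exists>vs. M = (\<Sum>v\<leftarrow>vs. ketbra v v)"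
  using assms
proof (induction "card {i. M $ i $ i \<noteq> 0}" arbitrary: M rule: less_induct)
  case less
  show ?case
  proof (cases "\<exists>i. M $ i $ i \<noteq> 0")
    case False
    then have "M = 0" using psd_eq_zero[OF less.prems] by blast
    then show ?thesis by (intro exI[of _ "[]"]) simp
  next
    case True
    then obtain i where i: "M $ i $ i \<noteq> 0" by blast
    obtain v where v: "psd (M - ketbra v v)" "(M - ketbra v v) $ i $ i = 0"
      using psd_cholesky_step[OF less.prems i] .
    let ?M = "M - ketbra v v"
    \<comment> \<open>Subtraction turns a zero diagonal entry into -|v_j|^2, which positivity forces
      to be zero.\<close>
    have "?M $ j $ j = 0" if "M $ j $ j = 0" for j
    proof -
      have "?M $ j $ j = - of_real ((cmod (v $ j))\<^sup>2)"
        using that by (simp add: ketbra_def complex_norm_square del: of_real_power)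
      moreover have "0 \<le> Re (?M $ j $ j)" using psd_diag(1)[OF v(1)] .
      ultimately show ?thesis by simp
    qed
    then have "{j. ?M $ j $ j \<noteq> 0} \<subset> {j. M $ j $ j \<noteq> 0}" using i v(2) by blast
    then have "card {j. ?M $ j $ j \<noteq> 0} < card {j. M $ j $ j \<noteq> 0}"
      by (intro psubset_card_mono) auto
    from less.hyps[OF this v(1)] obtain vs where "?M = (\<Sum>v\<leftarrow>vs. ketbra v v)" by blast
    then have "M = (\<Sum>v\<leftarrow>v # vs. ketbra v v)" by (simp add: algebra_simps)
    then show ?thesis by blast
  qed
qed

subsection \<open>Choi matrices and Kraus operators\<close>

lemma choi_nth:
  "choi \<Phi> $ p $ q = \<Phi> (ketbra (axis (fst p) 1) (axis (fst q) 1)) $ snd p $ snd q"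
proof -
  let ?e = "\<lambda>j. axis j 1 :: complex^'a"
  have "choi \<Phi> $ p $ q = (\<Sum>j\<in>UNIV. \<Sum>k\<in>UNIV. if k = fst q then
      if j = fst p then \<Phi> (ketbra (?e j) (?e k)) $ snd p $ snd q else 0 else 0)"
    unfolding choi_def kron_def sum_component vec_lambda_beta
    by (intro sum.cong refl) (auto simp: ketbra_def axis_def)
  then show ?thesis by simp
qed

lemma mvec_ketbra_axis: "mvec K $ p = (K *v axis (fst p) 1) $ snd p"
  by (simp add: mvec_def mult_vec_axis)

lemma conjugation_ketbra: "K ** ketbra u v ** dagger L = ketbra (K *v u) (L *v v)"
  by (simp add: mult_ketbra ketbra_mult)

text \<open>The left side depends on \<Phi> alone, while the right side exposes the quadratic form
  and the kernel in terms of the Kraus operators.\<close>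

lemma kraus_ops_choi:
  assumes "kraus_ops \<Phi> Ks"
  shows "choi \<Phi> = (\<Sum>K\<leftarrow>Ks. ketbra (mvec K) (mvec K))"
proof -
  have "choi \<Phi> $ p $ q = (\<Sum>K\<leftarrow>Ks. ketbra (mvec K) (mvec K)) $ p $ q" for p q
    using assms unfolding choi_nth kraus_ops_def
    by (simp add: sum_list_nth conjugation_ketbra)
       (simp add: mvec_ketbra_axis ketbra_def)
  then show ?thesis by (simp add: vec_eq_iff)
qed

abbreviation clinear :: "('n::finite cmat \<Rightarrow> 'n cmat) \<Rightarrow> bool"
  where "clinear \<equiv> Vector_Spaces.linear cmat_scale cmat_scale"

lemma clinear_iff:
  "clinear \<Phi> \<longleftrightarrow> (\<forall>A B. \<Phi> (A + B) = \<Phi> A + \<Phi> B) \<and>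
    (\<forall>c A. \<Phi> (cmat_scale c A) = cmat_scale c (\<Phi> A))"
  using cmat.vector_space_axioms by (auto simp: Vector_Spaces.linear_iff)

lemma clinear_add: "clinear \<Phi> \<Longrightarrow> \<Phi> (A + B) = \<Phi> A + \<Phi> B"
  by (simp add: clinear_iff)

lemma clinear_cmat_scale: "clinear \<Phi> \<Longrightarrow> \<Phi> (cmat_scale c A) = cmat_scale c (\<Phi> A)"
  by (simp add: clinear_iff)

lemma clinear_scaleR: "clinear \<Phi> \<Longrightarrow> \<Phi> (c *\<^sub>R A) = c *\<^sub>R \<Phi> A"
  by (metis clinear_cmat_scale cmat_scale_of_real)

lemma clinear_diff: "clinear \<Phi> \<Longrightarrow> \<Phi> (A - B) = \<Phi> A - \<Phi> B"
  using clinear_add[of \<Phi> "A - B" B] by simp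

lemma clinear_sum: "clinear \<Phi> \<Longrightarrow> \<Phi> (\<Sum>i\<in>I. f i) = (\<Sum>i\<in>I. \<Phi> (f i))"
  using clinear_scaleR[of \<Phi> 0 0]
  by (induction I rule: infinite_finite_induct) (simp_all add: clinear_add)

lemma clinear_comp: "clinear \<Phi> \<Longrightarrow> clinear \<Psi> \<Longrightarrow> clinear (\<Phi> \<circ> \<Psi>)"
  by (simp add: clinear_iff)

lemma cmat_scale_mult_left: "cmat_scale c A ** B = cmat_scale c (A ** B)"
  by (simp add: cmat_scale_def matrix_matrix_mult_def vec_eq_iff sum_distrib_left mult_ac)

lemma cmat_scale_mult_right: "A ** cmat_scale c B = cmat_scale c (A ** B)"
  by (simp add: cmat_scale_def matrix_matrix_mult_def vec_eq_iff sum_distrib_left mult_ac)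

lemma clinear_conjugation: "clinear (\<lambda>X. A ** X ** B)"
  by (simp add: clinear_iff cmat_scale_mult_left cmat_scale_mult_right matrix_add_ldistrib
      cmat_add_rdistrib)

lemma clinear_sum_list:
  assumes "\<And>x. x \<in> set xs \<Longrightarrow> clinear (F x)"
  shows "clinear (\<lambda>X. \<Sum>x\<leftarrow>xs. F x X)"
  using assms
proof (induction xs)
  case Nil
  show ?case by (simp add: clinear_iff)
next
  case (Cons a xs)
  then have "clinear (F a)" "clinear (\<lambda>X. \<Sum>x\<leftarrow>xs. F x X)" by simp_all
  then show ?case by (simp add: clinear_iff cmat.scale_right_distrib)
qed

lemma kraus_ops_clinear:
  assumes "kraus_ops \<Phi> Ks"
  shows "clinear \<Phi>"
proof -
  have "\<Phi> = (\<lambda>X. \<Sum>K\<leftarrow>Ks. K ** X ** dagger K)"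
    using assms by (auto simp: kraus_ops_def)
  then show ?thesis using clinear_sum_list[of Ks "\<lambda>K X. K ** X ** dagger K"]
    by (simp add: clinear_conjugation)
qed

lemma cmat_expansion:
  "X = (\<Sum>i\<in>UNIV. \<Sum>j\<in>UNIV. cmat_scale (X $ i $ j) (ketbra (axis i 1) (axis j 1)))"
proof -
  have "(\<Sum>i\<in>UNIV. \<Sum>j\<in>UNIV. cmat_scale (X $ i $ j) (ketbra (axis i 1) (axis j 1))) $ a $ b =
    X $ a $ b" for a b
  proof -
    have "(\<Sum>i\<in>UNIV. \<Sum>j\<in>UNIV. cmat_scale (X $ i $ j) (ketbra (axis i 1) (axis j 1))) $ a $ b =
      (\<Sum>i\<in>UNIV. \<Sum>j\<in>UNIV. if j = b then if i = a then X $ i $ j else 0 else 0)"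
      unfolding sum_component
      by (intro sum.cong refl) (auto simp: cmat_scale_def ketbra_def axis_def)
    then show ?thesis by simp
  qed
  then show ?thesis by (simp add: vec_eq_iff)
qed

text \<open>The blocks of the Choi matrix are the values at the matrix units, which span all
  matrices.\<close>

lemma clinear_eq_if_choi_eq:
  assumes "clinear \<Phi>" "clinear \<Psi>" "choi \<Phi> = choi \<Psi>"
  shows "\<Phi> = \<Psi>"
proof
  fix X
  have "\<Phi> (ketbra (axis i 1) (axis j 1)) = \<Psi> (ketbra (axis i 1) (axis j 1))" for i j
  proof -
    have "\<Phi> (ketbra (axis i 1) (axis j 1)) $ a $ b = \<Psi> (ketbra (axis i 1) (axis j 1)) $ a $ b"
      for a b
      using arg_cong[OF assms(3), of "\<lambda>C. C $ (i, a) $ (j, b)"] by (simp add: choi_nth)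
    then show ?thesis by (simp add: vec_eq_iff)
  qed
  then show "\<Phi> X = \<Psi> X"
    using assms(1,2) by (subst (1 2) cmat_expansion) (simp add: clinear_sum clinear_cmat_scale)
qed

text \<open>Choi's argument: the vectors of a rank-one decomposition, reshaped to matrices, are
  Kraus operators of a map with the same Choi matrix.\<close>

lemma psd_choi_imp_kraus_ops:
  assumes "clinear \<Phi>" "psd (choi \<Phi>)"
  shows "\<exists>Ks. kraus_ops \<Phi> Ks"
proof -
  obtain vs where vs: "choi \<Phi> = (\<Sum>v\<leftarrow>vs. ketbra v v)"
    using psd_decomposition[OF assms(2)] by blast
  define Ks where "Ks = map unvec vs"
  define \<Psi> where "\<Psi> = (\<lambda>X. \<Sum>K\<leftarrow>Ks. K ** X ** dagger K)"
  have k: "kraus_ops \<Psi> Ks" by (simp add: kraus_ops_def \<Psi>_def)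
  have "choi \<Psi> = choi \<Phi>" unfolding kraus_ops_choi[OF k] vs by (simp add: Ks_def o_def)
  then show ?thesis
    using clinear_eq_if_choi_eq[OF assms(1) kraus_ops_clinear[OF k]] k by auto
qed

lemma sum_list_sum_swap: "(\<Sum>i\<in>I. \<Sum>x\<leftarrow>xs. f i x) = (\<Sum>x\<leftarrow>xs. \<Sum>i\<in>I. f i x)"
  by (induction xs) (simp_all add: sum.distrib)

lemma sum_list_nonneg_Reals:
  "(\<And>x. x \<in> set xs \<Longrightarrow> f x \<in> \<real>\<^sub>\<ge>\<^sub>0) \<Longrightarrow> (\<Sum>x\<leftarrow>xs. f x) \<in> (\<real>\<^sub>\<ge>\<^sub>0 :: complex set)"
  by (induction xs) (auto simp: complex_nonneg_Reals_iff)

lemma kraus_ops_imp_completely_positive: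
  fixes \<Phi> :: "'n::finite cmat \<Rightarrow> 'n cmat"
  assumes k: "kraus_ops \<Phi> Ks"
  shows "completely_positive \<Phi>"
  unfolding completely_positive_def
proof (intro conjI allI impI)
  show "clinear \<Phi>" using kraus_ops_clinear[OF k] .
  fix m and X :: "nat \<Rightarrow> nat \<Rightarrow> 'n cmat"
  assume X: "block_psd m X"
  show "block_psd m (\<lambda>a b. \<Phi> (X a b))"
    unfolding block_psd_def
  proof
    fix v :: "nat \<Rightarrow> complex^'n"
    \<comment> \<open>Moving \<open>K\<close> across the inner product replaces \<open>v a\<close>
      by \<open>dagger K *v v a\<close>, so each \<open>K\<close> contributes a value of the form of
      \<open>X\<close>.\<close>
    have "cinner (v a) (\<Phi> (X a b) *v v b) =
        (\<Sum>K\<leftarrow>Ks. cinner (dagger K *v v a) (X a b *v (dagger K *v v b)))" for a b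
      using k unfolding kraus_ops_def
      by (simp add: sum_list_mult_vec cinner_sum_list_right cinner_mult_vec_right[of _ K for K]
          matrix_vector_mul_assoc[symmetric])
    then have "(\<Sum>a<m. \<Sum>b<m. cinner (v a) (\<Phi> (X a b) *v v b)) =
        (\<Sum>K\<leftarrow>Ks. \<Sum>a<m. \<Sum>b<m. cinner (dagger K *v v a) (X a b *v (dagger K *v v b)))"
      by (simp add: sum_list_sum_swap)
    also have "\<dots> \<in> \<real>\<^sub>\<ge>\<^sub>0"
      using X by (intro sum_list_nonneg_Reals)
        (simp add: block_psd_def[of m X])
    finally show "(\<Sum>a<m. \<Sum>b<m. cinner (v a) (\<Phi> (X a b) *v v b)) \<in> \<real>\<^sub>\<ge>\<^sub>0" .
  qed
qed

text \<open>Splitting the pair index gives the block sum that \<open>block_psd\<close> speaks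
  of.\<close>

lemma choi_form:
  "cinner w (choi \<Phi> *v w) = (\<Sum>j\<in>UNIV. \<Sum>k\<in>UNIV. cinner (\<chi> i. w $ (j, i))
    (\<Phi> (ketbra (axis j 1) (axis k 1)) *v (\<chi> i. w $ (k, i))))"
proof -
  have "cinner w (choi \<Phi> *v w) = (\<Sum>j\<in>UNIV. \<Sum>i\<in>UNIV. cnj (w $ (j, i)) *
    (\<Sum>k\<in>UNIV. \<Sum>l\<in>UNIV. \<Phi> (ketbra (axis j 1) (axis k 1)) $ i $ l * w $ (k, l)))"
    unfolding cinner_def matrix_vector_mult_def
    by (simp add: choi_nth sum.cartesian_product case_prod_beta flip: UNIV_Times_UNIV)
  also have "\<dots> = (\<Sum>j\<in>UNIV. \<Sum>k\<in>UNIV. \<Sum>i\<in>UNIV. cnj (w $ (j, i)) *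
    (\<Sum>l\<in>UNIV. \<Phi> (ketbra (axis j 1) (axis k 1)) $ i $ l * w $ (k, l)))"
    by (subst sum_distrib_left, subst (2) sum.swap) (rule refl)
  finally show ?thesis by (simp add: cinner_def matrix_vector_mult_def)
qed

lemma completely_positive_imp_psd_choi:
  fixes \<Phi> :: "'n::finite cmat \<Rightarrow> 'n cmat"
  assumes "completely_positive \<Phi>"
  shows "psd (choi \<Phi>)"
proof -
  define m where "m = CARD('n)"
  obtain h :: "nat \<Rightarrow> 'n" where "bij_betw h {0..<m} UNIV"
    using ex_bij_betw_nat_finite[of "UNIV :: 'n set"] by (auto simp: m_def)
  then have h: "bij_betw h {..<m} UNIV" by (simp add: atLeast0LessThan)
  \<comment> \<open>The unnormalised maximally entangled state, whose form is |z|^2; applying \<Phi>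
    to its blocks yields the Choi matrix. The bijection \<open>h\<close> translates numeric block
    indices into matrix indices.\<close>
  define X where "X a b = ketbra (axis (h a) 1 :: complex^'n) (axis (h b) 1)" for a b
  have "block_psd m X"
    unfolding block_psd_def
  proof
    fix v :: "nat \<Rightarrow> complex^'n"
    define z where "z = (\<Sum>b<m. v b $ h b)"
    have "(\<Sum>a<m. \<Sum>b<m. cinner (v a) (X a b *v v b)) =
        (\<Sum>a<m. \<Sum>b<m. cnj (v a $ h a) * v b $ h b)"
      by (simp add: X_def ketbra_mult_vec cinner_scale_right cinner_axis_left cinner_axis_right
          mult.commute)
    also have "\<dots> = cnj z * z" by (simp add: z_def sum_product)
    also have "\<dots> = of_real ((cmod z)\<^sup>2)" by (simp add: complex_norm_square mult.commute del: of_real_power)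
    finally show "(\<Sum>a<m. \<Sum>b<m. cinner (v a) (X a b *v v b)) \<in> \<real>\<^sub>\<ge>\<^sub>0" by simp
  qed
  then have psd: "block_psd m (\<lambda>a b. \<Phi> (X a b))"
    using assms by (simp add: completely_positive_def)
  have "cinner w (choi \<Phi> *v w) \<in> \<real>\<^sub>\<ge>\<^sub>0" for w
  proof -
    define F where "F j k = cinner (\<chi> i. w $ (j, i))
      (\<Phi> (ketbra (axis j 1) (axis k 1)) *v (\<chi> i. w $ (k, i)))" for j k
    have "(\<Sum>a<m. \<Sum>b<m. F (h a) (h b)) \<in> \<real>\<^sub>\<ge>\<^sub>0"
      using psd[unfolded block_psd_def, rule_format, of "\<lambda>a. \<chi> i. w $ (h a, i)"]
      by (simp add: F_def X_def)
    also have "(\<Sum>a<m. \<Sum>b<m. F (h a) (h b)) = (\<Sum>a<m. \<Sum>k\<in>UNIV. F (h a) k)"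
      by (intro sum.cong refl sum.reindex_bij_betw[OF h])
    also have "\<dots> = (\<Sum>j\<in>UNIV. \<Sum>k\<in>UNIV. F j k)"
      by (rule sum.reindex_bij_betw[OF h])
    finally show ?thesis by (simp add: choi_form F_def)
  qed
  then show ?thesis by (simp add: psd_def)
qed

lemma completely_positive_imp_kraus_ops: "completely_positive \<Phi> \<Longrightarrow> \<exists>Ks. kraus_ops \<Phi> Ks"
  by (intro psd_choi_imp_kraus_ops completely_positive_imp_psd_choi)
     (simp_all add: completely_positive_def)

lemma sum_ketbra_form:
  "cinner w ((\<Sum>x\<leftarrow>xs. ketbra (f x) (f x)) *v w) = of_real (\<Sum>x\<leftarrow>xs. (cmod (cinner (f x) w))\<^sup>2)"
proof (induction xs)
  case (Cons a xs)
  have "cinner w (ketbra (f a) (f a) *v w) = cinner (f a) w * cnj (cinner (f a) w)"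
    by (simp add: ketbra_mult_vec cinner_scale_right cnj_cinner)
  also have "\<dots> = of_real ((cmod (cinner (f a) w))\<^sup>2)"
    by (simp add: complex_norm_square del: of_real_power)
  finally show ?case
    using Cons by (simp add: matrix_vector_mult_add_rdistrib cinner_add_right)
qed simp

lemma sum_squares_eq_0_iff:
  "(\<Sum>x\<leftarrow>xs. (cmod (f x))\<^sup>2) = 0 \<longleftrightarrow> (\<forall>x\<in>set xs. f x = 0)"
  by (subst sum_list_nonneg_eq_0_iff) auto

text \<open>The form is a sum of squared moduli, so it vanishes at a kernel vector only if every
  summand does.\<close>

lemma sum_ketbra_kernel:
  "(\<Sum>x\<leftarrow>xs. ketbra (f x) (f x)) *v w = 0 \<longleftrightarrow> (\<forall>x\<in>set xs. cinner (f x) w = 0)"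
proof
  assume "(\<Sum>x\<leftarrow>xs. ketbra (f x) (f x)) *v w = 0"
  then have "(\<Sum>x\<leftarrow>xs. (cmod (cinner (f x) w))\<^sup>2) = 0"
    using sum_ketbra_form[of w f xs] by simp
  then show "\<forall>x\<in>set xs. cinner (f x) w = 0" by (simp only: sum_squares_eq_0_iff)
next
  assume "\<forall>x\<in>set xs. cinner (f x) w = 0"
  then show "(\<Sum>x\<leftarrow>xs. ketbra (f x) (f x)) *v w = 0"
    unfolding sum_list_mult_vec ketbra_mult_vec by (induction xs) simp_all
qed

section \<open>Double orthogonal complements, the Kraus subspace, and conditions (i) and
  (ii)\<close>

lemma subspace_biorthogonal:
  fixes S :: "'a::euclidean_space set"
  assumes "subspace S" "\<And>G. (\<And>A. A \<in> S \<Longrightarrow> A \<bullet> G = 0) \<Longrightarrow> C \<bullet> G = 0"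
  shows "C \<in> S"
proof -
  have "C \<in> S\<^sup>\<bottom>\<^sup>\<bottom>"
    using assms(2) by (auto simp: orthogonal_comp_def orthogonal_def inner_commute)
  then show ?thesis using orthogonal_comp_self[OF assms(1)] by simp
qed

text \<open>Reduces to the real double complement: a complex span is closed under multiplication by
  \<i>, so real orthogonality to it already gives complex orthogonality.\<close>

lemma cmat_span_biorthogonal:
  assumes "\<And>G. (\<And>A. A \<in> S \<Longrightarrow> hs_inner A G = 0) \<Longrightarrow> hs_inner C G = 0"
  shows "C \<in> cmat.span S"
proof (rule subspace_biorthogonal)
  show "subspace (cmat.span S)"
    by (auto simp: subspace_def cmat.span_zero cmat.span_add cmat.span_scale
        simp flip: cmat_scale_of_real)
  fix G
  assume G: "\<And>A. A \<in> cmat.span S \<Longrightarrow> A \<bullet> G = 0"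
  have "hs_inner A G = 0" if "A \<in> S" for A
    using G[OF cmat.span_base[OF that]]
      G[OF cmat.span_scale[OF cmat.span_base[OF that], of \<i>]]
    by (simp add: inner_eq_Re_hs_inner hs_inner_scale_left complex_eq_iff)
  then show "C \<bullet> G = 0" using assms[of G] by (simp add: inner_eq_Re_hs_inner)
qed

lemma hs_inner_span_left:
  assumes "A \<in> cmat.span S" "\<And>B. B \<in> S \<Longrightarrow> hs_inner B G = 0"
  shows "hs_inner A G = 0"
  using assms(1)
  by (induction rule: cmat.span_induct_alt)
     (simp_all add: hs_inner_add_left hs_inner_scale_left assms(2))

lemma hs_orthogonal_span: "hs_orthogonal (cmat.span S) = hs_orthogonal S"
  using hs_inner_span_left cmat.span_base by (fastforce simp: hs_orthogonal_def)

lemma subspace_hs_orthogonal: "cmat.subspace (hs_orthogonal S)"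
  by (simp add: cmat.subspace_def hs_orthogonal_def hs_inner_add_right hs_inner_scale_right)

lemma kraus_ops_choi_kernel:
  assumes "kraus_ops \<Phi> Ks"
  shows "choi \<Phi> *v mvec G = 0 \<longleftrightarrow> G \<in> hs_orthogonal (set Ks)"
  unfolding kraus_ops_choi[OF assms] sum_ketbra_kernel hs_orthogonal_def
  by (simp add: hs_inner_eq_cinner)

text \<open>All Kraus families have the same orthogonal complement, because it is the kernel of the
  Choi matrix (\<open>kraus_ops_choi_kernel\<close>). Taking complements again shows that they have
  the same span, so the definite description is justified.\<close>

lemma kraus_subspace_eq:
  assumes k: "kraus_ops \<Phi> Ks"
  shows "kraus_subspace \<Phi> = cmat.span (set Ks)"
proof -
  have sub: "set Ks1 \<subseteq> cmat.span (set Ks2)" if "kraus_ops \<Phi> Ks1" "kraus_ops \<Phi> Ks2" for Ks1 Ks2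
  proof
    fix C assume C: "C \<in> set Ks1"
    have eq: "hs_orthogonal (set Ks1) = hs_orthogonal (set Ks2)"
      using kraus_ops_choi_kernel[OF that(1)] kraus_ops_choi_kernel[OF that(2)] by blast
    show "C \<in> cmat.span (set Ks2)"
    proof (rule cmat_span_biorthogonal)
      fix G assume "\<And>A. A \<in> set Ks2 \<Longrightarrow> hs_inner A G = 0"
      then have "G \<in> hs_orthogonal (set Ks1)" unfolding eq by (simp add: hs_orthogonal_def)
      then show "hs_inner C G = 0" using C by (simp add: hs_orthogonal_def)
    qed
  qed
  have uniq: "cmat.span (set Ks') = cmat.span (set Ks)" if "kraus_ops \<Phi> Ks'" for Ks'
    using sub[OF that k] sub[OF k that] cmat.span_eq by blast
  show ?thesis
    unfolding kraus_subspace_def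
  proof (rule the_equality)
    show "\<exists>Ks'. kraus_ops \<Phi> Ks' \<and> cmat.span (set Ks) = cmat.span (set Ks')" using k by blast
  qed (elim exE conjE, simp only: uniq)
qed

text \<open>
  Since \<open>\<langle>K y, G x\<rangle> = \<langle>K |y\<rangle>\<langle>x|, G\<rangle>\<close>, this says that right multiplication by \<open>|y\<rangle>\<langle>x|\<close> maps the
  span of \<open>Ks\<close> into itself.
\<close>

definition ketbra_stable :: "'n::finite cmat list \<Rightarrow> complex^'n \<Rightarrow> complex^'n \<Rightarrow> bool"
  where "ketbra_stable Ks x y \<longleftrightarrow>
    (\<forall>G\<in>hs_orthogonal (set Ks). \<forall>K\<in>set Ks. cinner (K *v y) (G *v x) = 0)"

lemma kraus_ops_ketbra:
  assumes "kraus_ops \<Phi> Ks"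
  shows "\<Phi> (ketbra y y) = (\<Sum>K\<leftarrow>Ks. ketbra (K *v y) (K *v y))"
  using assms by (simp add: kraus_ops_def conjugation_ketbra)

text \<open>The image of \<open>ketbra y y\<close> is a sum of rank-one terms on the vectors
  \<open>K *v y\<close>, so it kills \<open>G *v x\<close> exactly when all of them are orthogonal
  to it.\<close>

lemma image_condition_iff:
  assumes k: "kraus_ops \<Phi> Ks"
  shows "image_condition \<Phi> x x' \<longleftrightarrow> ketbra_stable Ks x x' \<and> ketbra_stable Ks x x"
  unfolding image_condition_def kraus_subspace_eq[OF k] hs_orthogonal_span ketbra_stable_def
    kraus_ops_ketbra[OF k] matrix_vector_mul_assoc[symmetric] sum_ketbra_kernel
  by blast

lemma kraus_condition_iff:
  assumes k: "kraus_ops \<Phi> Ks" and B: "is_cmat_basis B (hs_orthogonal (kraus_subspace \<Phi>))"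
  shows "kraus_condition Ks B x x' \<longleftrightarrow> ketbra_stable Ks x x' \<and> ketbra_stable Ks x x"
proof -
  have span: "cmat.span B = hs_orthogonal (set Ks)"
    using B by (simp add: is_cmat_basis_def kraus_subspace_eq[OF k] hs_orthogonal_span)
  have *: "(\<forall>K\<in>set Ks. \<forall>G\<in>B. cinner y ((dagger K ** G) *v x) = 0) \<longleftrightarrow> ketbra_stable Ks x y" for y
  proof -
    have i: "cinner y ((dagger K ** G) *v x) = cinner (K *v y) (G *v x)" for K G
      by (simp add: cinner_mult_vec_right[of _ "dagger K"] flip: matrix_vector_mul_assoc)
    \<comment> \<open>The condition is linear in \<open>G\<close> and therefore passes from the
      basis to its span.\<close>
    have "cinner (K *v y) (G *v x) = 0"
      if "G \<in> cmat.span B" "\<forall>G\<in>B. cinner (K *v y) (G *v x) = 0" for K G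
      using that(1)
    proof (induction rule: cmat.span_induct_alt)
      case (step c A C)
      have "(cmat_scale c A + C) *v x = c *s (A *v x) + C *v x"
        by (simp add: matrix_vector_mult_def cmat_scale_def vec_eq_iff sum.distrib algebra_simps
            sum_distrib_left)
      then show ?case using step that(2) by (simp add: cinner_add_right cinner_scale_right)
    qed simp
    then show ?thesis
      unfolding i ketbra_stable_def span[symmetric] using cmat.span_base by blast
  qed
  show ?thesis unfolding kraus_condition_def *[symmetric] by blast
qed

lemma cmat_basis_exists:
  assumes "cmat.subspace S"
  shows "\<exists>B. is_cmat_basis B S"
proof -
  obtain B where "B \<subseteq> S" "cmat.independent B" "S \<subseteq> cmat.span B"
    using cmat.maximal_independent_subset[of S] by blast
  then show ?thesis using cmat.span_minimal[OF \<open>B \<subseteq> S\<close> assms] by (auto simp: is_cmat_basis_def)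
qed

subsection \<open>Domination of quadratic forms and rank\<close>

text \<open>Both sums are constant along the zero set \<open>Z\<close> of \<open>D\<close>, so it
  suffices to study N / D on the unit sphere of the orthogonal complement of \<open>Z\<close>. There
  \<open>D\<close> is positive, compactness provides the maximum \<open>C\<close>, and a maximiser
  serves as \<open>B0\<close>.\<close>

lemma sum_squares_domination:
  fixes f g :: "'i \<Rightarrow> 'a::euclidean_space \<Rightarrow> complex" and xs :: "'i list"
  defines "D \<equiv> \<lambda>B. \<Sum>x\<leftarrow>xs. (cmod (f x B))\<^sup>2" and "N \<equiv> \<lambda>B. \<Sum>x\<leftarrow>xs. (cmod (g x B))\<^sup>2"
  assumes f: "\<And>x. linear (f x)" and g: "\<And>x. linear (g x)"
    and ker: "\<And>B. D B = 0 \<Longrightarrow> N B = 0"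
  shows "\<exists>C\<ge>0. (\<forall>B. N B \<le> C * D B) \<and>
    (\<forall>B. N B > 0 \<longrightarrow> (\<exists>B0. D B0 > 0 \<and> N B0 = C * D B0))"
proof -
  define Z where "Z = {B. D B = 0}"
  have Z_iff: "B \<in> Z \<longleftrightarrow> (\<forall>x\<in>set xs. f x B = 0)" for B
    unfolding Z_def D_def by (simp only: mem_Collect_eq sum_squares_eq_0_iff)
  have Zg: "B \<in> Z \<Longrightarrow> \<forall>x\<in>set xs. g x B = 0" for B
    unfolding Z_def mem_Collect_eq by (drule ker) (simp only: N_def sum_squares_eq_0_iff)
  have Z: "subspace Z"
    by (simp add: subspace_def Z_iff linear_0[OF f] linear_add[OF f] linear_scale[OF f])
  have D0: "0 \<le> D B" and N0: "0 \<le> N B" for B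
    unfolding D_def N_def by (auto intro!: sum_list_nonneg)
  \<comment> \<open>The component in \<open>Z\<close> contributes to no \<open>f x\<close> and, by
    \<open>ker\<close>, to no \<open>g x\<close>.\<close>
  have split: "\<exists>w\<in>Z\<^sup>\<bottom>. D B = D w \<and> N B = N w" for B
  proof -
    obtain z w where zw: "z \<in> Z" "w \<in> Z\<^sup>\<bottom>" "B = z + w"
      using subspace_sum_orthogonal_comp[OF Z] by (metis UNIV_I set_plus_elim)
    have "D B = D w" "N B = N w"
      using zw(1) Zg[OF zw(1)] unfolding D_def N_def zw(3) linear_add[OF f] linear_add[OF g] Z_iff
      by (simp_all cong: map_cong)
    then show ?thesis using zw(2) by blast
  qed
  have scale: "D (c *\<^sub>R B) = c\<^sup>2 * D B" "N (c *\<^sub>R B) = c\<^sup>2 * N B" for c B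
    by (simp_all add: D_def N_def linear_scale[OF f] linear_scale[OF g] power_mult_distrib
        sum_list_const_mult)
  have D_pos: "D w > 0" if "w \<in> Z\<^sup>\<bottom>" "w \<noteq> 0" for w
  proof (rule ccontr)
    assume "\<not> D w > 0"
    then have "w \<in> Z" using D0[of w] by (simp add: Z_def)
    then show False
      using that by (auto simp: orthogonal_comp_def orthogonal_def)
  qed
  define S where "S = Z\<^sup>\<bottom> \<inter> sphere 0 1"
  show ?thesis
  proof (cases "S = {}")
    case True
    \<comment> \<open>If the sphere is empty, the complement is trivial and \<open>N\<close>
      vanishes identically, so \<open>C\<close> = 0 works and the attainment clause is
      vacuous.\<close>
    have "N B = 0" for B
    proof -
      obtain w where w: "w \<in> Z\<^sup>\<bottom>" "N B = N w" using split by blast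
      have "w = 0"
      proof (rule ccontr)
        assume "w \<noteq> 0"
        then have "(1 / norm w) *\<^sub>R w \<in> S"
          using w(1) subspace_scale[OF subspace_orthogonal_comp[of Z]] by (simp add: S_def)
        then show False using True by simp
      qed
      then show ?thesis using w scale(2)[of 0 0] by simp
    qed
    then show ?thesis by (intro exI[of _ 0]) simp
  next
    case False
    have "compact S"
      unfolding S_def by (intro closed_Int_compact closed_subspace subspace_orthogonal_comp) simp
    moreover have "continuous_on S (\<lambda>B. N B / D B)"
    proof -
      have cont: "continuous_on S (\<lambda>B. \<Sum>x\<leftarrow>xs. (cmod (h x B))\<^sup>2)"
        if "\<And>x. linear (h x)" for h :: "'i \<Rightarrow> 'a \<Rightarrow> complex"
      proof -
        have "continuous_on S (h x)" for x
          using that by (intro linear_continuous_on) (simp add: linear_linear)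
        then have "continuous_on S (\<lambda>B. (cmod (h x B))\<^sup>2)" for x
          by (intro continuous_intros)
        then show ?thesis by (induction xs) (simp_all add: continuous_on_add)
      qed
      have "continuous_on S D" "continuous_on S N"
        unfolding D_def N_def using cont f g by blast+
      moreover have "\<forall>B\<in>S. D B \<noteq> 0" using D_pos by (fastforce simp: S_def)
      ultimately show ?thesis by (intro continuous_on_divide) auto
    qed
    ultimately obtain w0 where w0: "w0 \<in> S" "\<And>w. w \<in> S \<Longrightarrow> N w / D w \<le> N w0 / D w0"
      using continuous_attains_sup[of S "\<lambda>B. N B / D B"] False by blast
    define C where "C = N w0 / D w0"
    have "w0 \<noteq> 0" using w0(1) by (auto simp: S_def)
    then have "D w0 > 0" using w0(1) D_pos[of w0] by (simp add: S_def)
    then have eq: "N w0 = C * D w0" by (simp add: C_def)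
    have "C \<ge> 0" by (simp add: C_def D0 N0)
    moreover have "N B \<le> C * D B" for B
    proof -
      obtain w where w: "w \<in> Z\<^sup>\<bottom>" "D B = D w" "N B = N w" using split by blast
      show ?thesis
      proof (cases "w = 0")
        case True
        then show ?thesis using w scale[of 0 0] by simp
      next
        case False
        define c where "c = 1 / norm w"
        have c: "c > 0" using False by (simp add: c_def)
        have "c *\<^sub>R w \<in> S"
          using False w(1) subspace_scale[OF subspace_orthogonal_comp[of Z]]
          by (simp add: S_def c_def)
        then have "N (c *\<^sub>R w) / D (c *\<^sub>R w) \<le> C" using w0(2) by (simp add: C_def)
        then have "N w / D w \<le> C" using c by (simp add: scale)
        then show ?thesis using D_pos[OF w(1) False] w by (simp add: divide_le_eq)
      qed
    qed
    ultimately show ?thesis using eq \<open>D w0 > 0\<close> by blast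
  qed
qed

section \<open>Comparing ranks\<close>

lemma rank_mult_le_left:
  fixes A :: "complex^'n^'m" and B :: "complex^'k^'n"
  shows "rank (A ** B) \<le> rank A"
proof -
  have "row i (A ** B) = transpose B *v row i A" for i
    by (simp add: row_def matrix_matrix_mult_def matrix_vector_mult_def transpose_def vec_eq_iff
        mult.commute)
  then have "rows (A ** B) = (*v) (transpose B) ` rows A"
    by (auto simp: rows_def)
  then show ?thesis
    unfolding row_rank_def_gen
    using vec.dim_image_le[OF matrix_vector_mul_linear_gen[of "transpose B"]] by metis
qed

text \<open>A row space is the annihilator of the kernel, so inclusion of kernels reverses for row
  spaces. The vector \<open>w0\<close> annihilates the rows of \<open>M2\<close> but not those of
  \<open>M1\<close>, which makes the inclusion strict.\<close>

lemma rank_less_if_kernel: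
  fixes M1 M2 :: "complex^'n^'m"
  assumes sub: "\<And>w. M1 *v w = 0 \<Longrightarrow> M2 *v w = 0" and w0: "M1 *v w0 \<noteq> 0" "M2 *v w0 = 0"
  shows "rank M2 < rank M1"
proof -
  have nth: "(A *v w) $ i = (\<Sum>k\<in>UNIV. row i A $ k * w $ k)" for A :: "complex^'n^'m" and w i
    by (simp add: row_def matrix_vector_mult_def)
  have "rows M2 \<subseteq> vec.span (rows M1)"
  proof
    fix c assume "c \<in> rows M2"
    then obtain i where c: "c = row i M2" by (auto simp: rows_def)
    show "c \<in> vec.span (rows M1)"
    proof (rule subspace_biorthogonal)
      show "subspace (vec.span (rows M1))"
      proof -
        have "r *\<^sub>R v = of_real r *s v" for r and v :: "complex^'n"
          by (simp add: vec_eq_iff) (simp add: scaleR_conv_of_real)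
        then show ?thesis by (auto simp: subspace_def vec.span_zero vec.span_add vec.span_scale)
      qed
      fix g assume g: "\<And>a. a \<in> vec.span (rows M1) \<Longrightarrow> a \<bullet> g = 0"
      \<comment> \<open>Matrix-vector multiplication pairs rows bilinearly, whereas the inner
        product conjugates; \<open>g'\<close> absorbs the conjugation. Testing a row and \<i> times
        it yields real and imaginary parts.\<close>
      define g' where "g' = (\<chi> k. cnj (g $ k))"
      have inner: "a \<bullet> g = Re (\<Sum>k\<in>UNIV. a $ k * g' $ k)" for a
        by (simp add: inner_vec_def inner_complex_def g'_def)
      have "(M1 *v g') $ j = 0" for j
      proof -
        have r: "row j M1 \<in> vec.span (rows M1)" by (auto simp: rows_def intro: vec.span_base)
        have "(\<Sum>k\<in>UNIV. (\<i> *s row j M1) $ k * g' $ k) = \<i> * (M1 *v g') $ j"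
          by (simp add: nth sum_distrib_left mult.assoc)
        then show ?thesis
          using g[OF r] g[OF vec.span_scale[OF r, of \<i>]]
          unfolding inner nth[symmetric] by (simp add: complex_eq_iff)
      qed
      then have "M2 *v g' = 0" by (intro sub) (simp add: vec_eq_iff)
      then show "c \<bullet> g = 0" unfolding inner c nth[symmetric] by simp
    qed
  qed
  then have "vec.span (rows M2) \<subseteq> vec.span (rows M1)" by (simp add: vec.span_minimal)
  moreover have "vec.span (rows M2) \<noteq> vec.span (rows M1)"
  proof
    assume eq: "vec.span (rows M2) = vec.span (rows M1)"
    have "(\<Sum>k\<in>UNIV. v $ k * w0 $ k) = 0" if "v \<in> vec.span (rows M2)" for v
      using that
    proof (induction rule: vec.span_induct_alt)
      case (step c a b)
      have "(\<Sum>k\<in>UNIV. a $ k * w0 $ k) = 0"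
        using step(1) w0(2) by (auto simp: rows_def nth[symmetric])
      then have "c * (\<Sum>k\<in>UNIV. a $ k * w0 $ k) + (\<Sum>k\<in>UNIV. b $ k * w0 $ k) = 0"
        using step by simp
      then show ?case by (simp add: distrib_right sum.distrib sum_distrib_left mult.assoc)
    qed simp
    then have "(M1 *v w0) $ i = 0" for i
      unfolding nth eq by (auto simp: rows_def intro: vec.span_base)
    then show False using w0(1) by (simp add: vec_eq_iff)
  qed
  ultimately show ?thesis unfolding row_rank_def_gen by (intro vec.dim_psubset) blast
qed

text \<open>Turns the substitution of \<open>B ** Q\<close> for \<open>B\<close> into a matrix
  factor, so that the rank argument can use it as a change of coordinates.\<close>

lemma kron_mult_mvec: "kron (transpose Q) (mat 1) *v mvec B = mvec (B ** Q)"
proof -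
  have "(kron (transpose Q) (mat 1) *v mvec B) $ (j, i) = mvec (B ** Q) $ (j, i)" for i j
  proof -
    have "(kron (transpose Q) (mat 1) *v mvec B) $ (j, i) =
        (\<Sum>k\<in>UNIV. \<Sum>l\<in>UNIV. if i = l then Q $ k $ j * B $ l $ k else 0)"
      unfolding matrix_vector_mult_def vec_lambda_beta UNIV_Times_UNIV[symmetric]
        sum.cartesian_product[symmetric]
      by (simp only: sum.cartesian_product)
         (intro sum.cong refl, auto simp: kron_def mat_def transpose_def mvec_def)
    then show ?thesis by (simp add: mvec_def matrix_matrix_mult_def mult.commute)
  qed
  then show ?thesis by (simp add: vec_eq_iff)
qed

lemma hs_inner_mult_ketbra: "hs_inner (K ** ketbra y x) B = cinner (K *v y) (B *v x)"
  using hs_inner_ketbra_right[of B "K *v y" x] cnj_hs_inner[of B "ketbra (K *v y) x"]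
  by (simp add: mult_ketbra cnj_cinner)

lemma linear_hs_inner: "linear (hs_inner K)"
  by (rule linearI, rule hs_inner_add_right) (metis hs_inner_scaleR_right scaleR_conv_of_real)

lemma conjugation_comp: "A ** (B ** X ** dagger B) ** dagger A = (A ** B) ** X ** dagger (A ** B)"
  by (simp add: dagger_mult matrix_mul_assoc)

lemma conjugation_scaleR: "(c *\<^sub>R A) ** X ** dagger (c *\<^sub>R A) = (c\<^sup>2) *\<^sub>R (A ** X ** dagger A)"
  by (simp add: dagger_scaleR cmat_scaleR_left cmat_scaleR_right power2_eq_square)

subsection \<open>The channel \<open>\<Psi>\<^sub>\<lambda>\<close> and its inverse\<close>

lemma trace_conjugation: "trace (A ** X ** dagger A) = trace (dagger A ** A ** X)"
  using trace_cyclic[of "A ** X" "dagger A"] by (simp add: matrix_mul_assoc)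

lemma trace_cmat_scaleR: "trace (c *\<^sub>R A) = of_real c * trace A" for A :: "complex^'n^'n"
  by (simp add: trace_eq_sum sum_distrib_left) (simp add: scaleR_conv_of_real)

lemma kraus_ops_psi: "kraus_ops (psi l x y) [psi_K l x, psi_L l x y]"
  by (simp add: kraus_ops_def psi_def)

definition psi_K_inv :: "real \<Rightarrow> complex^'n::finite \<Rightarrow> 'n cmat"
  where "psi_K_inv l x = mat 1 + (1 / sqrt (1 - l) - 1) *\<^sub>R ketbra x x"

definition psi_inv :: "real \<Rightarrow> complex^'n::finite \<Rightarrow> complex^'n \<Rightarrow> 'n cmat \<Rightarrow> 'n cmat"
  where "psi_inv l x y \<sigma> = psi_K_inv l x ** \<sigma> ** dagger (psi_K_inv l x) -
    (l / (1 - l)) *\<^sub>R (ketbra y x ** \<sigma> ** dagger (ketbra y x))"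

lemma clinear_psi_inv: "clinear (psi_inv l x y)"
  unfolding clinear_iff psi_inv_def
  by (simp add: cmat_scale_mult_left cmat_scale_mult_right cmat_distribs algebra_simps
      cmat.scale_right_diff_distrib flip: cmat_scale_of_real)

context
  fixes x y :: "complex^'n::finite" and l :: real
  assumes unit: "cinner x x = 1" "cinner y y = 1" and orth: "cinner x y = 0"
    and l: "0 < l" "l < 1"
begin

lemma cinner_y_x: "cinner y x = 0"
  using orth cinner_eq_0_commute by blast

lemma sqrt_one_minus_square: "sqrt (1 - l) * sqrt (1 - l) = 1 - l" and sqrt_one_minus_pos: "sqrt (1 - l) > 0"
  using l by simp_all

lemma ketbra_products:
  "ketbra x x ** ketbra x x = ketbra x x" "ketbra y x ** ketbra x x = ketbra y x"
  "ketbra x x ** ketbra y x = 0" "ketbra y x ** ketbra y x = 0"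
  by (simp_all add: ketbra_mult_ketbra unit orth cinner_y_x)

lemma dagger_psi_K: "dagger (psi_K l x) = psi_K l x"
  by (simp add: psi_K_def dagger_diff dagger_scaleR dagger_ketbra)

lemma psi_K_psi_K_inv: "psi_K l x ** psi_K_inv l x = mat 1"
  using sqrt_one_minus_pos unfolding psi_K_def psi_K_inv_def
  by (simp add: cmat_distribs ketbra_products algebra_simps)

lemma psi_K_inv_psi_K: "psi_K_inv l x ** psi_K l x = mat 1"
  using sqrt_one_minus_pos unfolding psi_K_def psi_K_inv_def
  by (simp add: cmat_distribs ketbra_products algebra_simps)

lemma ketbra_psi_K: "ketbra y x ** psi_K l x = sqrt (1 - l) *\<^sub>R ketbra y x"
  unfolding psi_K_def by (simp add: cmat_distribs ketbra_products algebra_simps)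

lemma ketbra_psi_K_inv: "ketbra y x ** psi_K_inv l x = (1 / sqrt (1 - l)) *\<^sub>R ketbra y x"
  unfolding psi_K_inv_def by (simp add: cmat_distribs ketbra_products algebra_simps)

lemma psi_K_ketbra: "psi_K l x ** ketbra y x = ketbra y x"
  unfolding psi_K_def by (simp add: cmat_distribs ketbra_products)

lemma psi_K_inv_ketbra: "psi_K_inv l x ** ketbra y x = ketbra y x"
  unfolding psi_K_inv_def by (simp add: cmat_distribs ketbra_products)

lemma psi_eq: "psi l x y X = psi_K l x ** X ** dagger (psi_K l x) +
    l *\<^sub>R (ketbra y x ** X ** dagger (ketbra y x))"
  using l by (simp add: psi_def psi_L_def conjugation_scaleR)

text \<open>Write E for \<open>ketbra y x\<close>. Multiplying \<open>psi_K_inv\<close> by E from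
  the left gives the factor \<open>1 / sqrt (1 - l)\<close>, so the first term of
  \<open>psi_inv\<close> leaves the excess \<open>l / (1 - l)\<close> times the conjugation by E.
  The subtracted term is fixed by \<open>psi\<close>, because \<open>psi_K\<close> fixes E and E
  squares to zero, and cancels this excess.\<close>

lemma psi_psi_inv: "psi l x y (psi_inv l x y \<sigma>) = \<sigma>"
proof -
  have lin: "clinear (psi l x y)" by (rule kraus_ops_clinear[OF kraus_ops_psi])
  have "psi l x y (psi_K_inv l x ** \<sigma> ** dagger (psi_K_inv l x)) =
      \<sigma> + (l / (1 - l)) *\<^sub>R (ketbra y x ** \<sigma> ** dagger (ketbra y x))"
    using l unfolding psi_eq conjugation_comp psi_K_psi_K_inv ketbra_psi_K_inv conjugation_scaleR
    by (simp add: power_divide)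
  moreover have "psi l x y (ketbra y x ** \<sigma> ** dagger (ketbra y x)) =
      ketbra y x ** \<sigma> ** dagger (ketbra y x)"
    unfolding psi_eq conjugation_comp psi_K_ketbra ketbra_products by simp
  ultimately show ?thesis
    by (simp only: psi_inv_def clinear_diff[OF lin] clinear_scaleR[OF lin]) simp
qed

lemma psi_inv_psi: "psi_inv l x y (psi l x y \<sigma>) = \<sigma>"
proof -
  note lin = clinear_psi_inv[of l x y]
  have "psi_inv l x y (psi_K l x ** \<sigma> ** dagger (psi_K l x)) =
      \<sigma> - l *\<^sub>R (ketbra y x ** \<sigma> ** dagger (ketbra y x))"
    using l unfolding psi_inv_def conjugation_comp psi_K_inv_psi_K ketbra_psi_K conjugation_scaleR
    by simp
  moreover have "psi_inv l x y (ketbra y x ** \<sigma> ** dagger (ketbra y x)) =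
      ketbra y x ** \<sigma> ** dagger (ketbra y x)"
    unfolding psi_inv_def conjugation_comp psi_K_inv_ketbra ketbra_products by simp
  ultimately show ?thesis
    by (simp only: psi_eq clinear_add[OF lin] clinear_scaleR[OF lin]) simp
qed

lemma inv_psi: "inv (psi l x y) = psi_inv l x y"
  by (rule inv_equality) (simp_all add: psi_psi_inv psi_inv_psi)

lemma psi_CPTP: "psi l x y \<in> CPTP"
proof -
  have "trace (psi l x y X) = trace X" for X
  proof -
    \<comment> \<open>Trace preservation amounts to K K + \<open>l\<close> \<open>ketbra x x\<close>
      = 1, with K the Hermitian matrix \<open>psi_K l x\<close>; \<open>ketbra x x\<close> arises
      from the second Kraus operator since \<open>y\<close> is a unit vector.\<close>
    have "trace (psi l x y X) = trace (psi_K l x ** psi_K l x ** X) +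
        of_real l * trace (ketbra x x ** X)"
      unfolding psi_eq trace_cmat_add trace_cmat_scaleR trace_conjugation
      by (simp add: dagger_psi_K dagger_ketbra ketbra_mult_ketbra unit)
    also have "\<dots> = trace ((psi_K l x ** psi_K l x + l *\<^sub>R ketbra x x) ** X)"
      by (simp add: trace_cmat_add trace_cmat_scaleR cmat_add_rdistrib cmat_scaleR_left)
    also have "psi_K l x ** psi_K l x + l *\<^sub>R ketbra x x = mat 1"
      using sqrt_one_minus_square unfolding psi_K_def
      by (simp add: cmat_distribs ketbra_products algebra_simps flip: scaleR_add_left)
    finally show ?thesis by simp
  qed
  then show ?thesis
    using kraus_ops_imp_completely_positive[OF kraus_ops_psi] by (simp add: CPTP_def)
qed

text \<open>A unitary channel maps \<open>ketbra x x\<close> to a rank-one matrix, whereas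
  \<open>psi\<close> produces a proper mixture of \<open>x\<close> and \<open>y\<close>:
  \<open>u\<close> would overlap with both, contradicting the zero off-diagonal entry.\<close>

lemma psi_not_unitary: "\<not> unitary_channel (psi l x y)"
proof
  assume "unitary_channel (psi l x y)"
  then obtain U where U: "psi l x y = (\<lambda>X. U ** X ** dagger U)" by (auto simp: unitary_channel_def)
  define u where "u = U *v x"
  have Kx: "psi_K l x *v x = sqrt (1 - l) *\<^sub>R x"
    by (simp add: psi_K_def matrix_vector_mult_diff_rdistrib cmat_scaleR_mult_vec ketbra_mult_vec
        unit algebra_simps)
  have "ketbra u u = psi l x y (ketbra x x)"
    by (simp add: U u_def conjugation_ketbra)
  also have "\<dots> = (1 - l) *\<^sub>R ketbra x x + l *\<^sub>R ketbra y y"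
    using sqrt_one_minus_square unfolding psi_eq conjugation_ketbra Kx ketbra_mult_vec unit
    by (simp add: ketbra_def vec_eq_iff)
  finally have eq: "cinner v u * cnj (cinner w u) =
      cinner v (((1 - l) *\<^sub>R ketbra x x + l *\<^sub>R ketbra y y) *v w)" for v w
    by (metis cinner_scale_right cnj_cinner ketbra_mult_vec mult.commute)
  have "cinner x u * cnj (cinner x u) = of_real (1 - l)"
    "cinner y u * cnj (cinner y u) = of_real l" "cinner x u * cnj (cinner y u) = 0"
    unfolding eq by (simp_all add: matrix_vector_mult_add_rdistrib cmat_scaleR_mult_vec
        ketbra_mult_vec unit orth cinner_y_x cinner_add_right cinner_scaleR_right)
  then show False using l by auto
qed

text \<open>
  If \<open>\<Phi> \<Psi>\<^sub>\<lambda>\<^sup>-\<^sup>1\<close> is conjugation by \<open>U\<close>, then \<open>U K\<^sub>\<lambda>\<close> and \<open>U L\<^sub>\<lambda>\<close> are Kraus operators of \<open>\<Phi>\<close>, and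
  \<open>U (|x\<rangle>\<langle>x| - \<surd>(1-\<lambda>) |y\<rangle>\<langle>y|)\<close>, which is orthogonal to both, violates the condition on
  \<open>\<langle>x|K\<^sup>\<dagger>G|x\<rangle>\<close>.
\<close>

lemma image_condition_not_unitary:
  assumes "image_condition \<Phi> x y"
  shows "\<not> unitary_channel (\<Phi> \<circ> psi_inv l x y)"
proof
  assume "unitary_channel (\<Phi> \<circ> psi_inv l x y)"
  then obtain U where U: "unitary U" "\<And>X. \<Phi> (psi_inv l x y X) = U ** X ** dagger U"
    by (auto simp: unitary_channel_def fun_eq_iff)
  have UU: "dagger U ** U = mat 1" using U(1) by (simp add: unitary_def)
  let ?Ks = "[U ** psi_K l x, U ** psi_L l x y]"
  have k: "kraus_ops \<Phi> ?Ks"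
    unfolding kraus_ops_def
  proof
    fix X
    have "\<Phi> X = U ** psi l x y X ** dagger U" using U(2)[of "psi l x y X"] by (simp add: psi_inv_psi)
    then show "\<Phi> X = (\<Sum>K\<leftarrow>?Ks. K ** X ** dagger K)"
      by (simp add: psi_def matrix_add_ldistrib cmat_add_rdistrib conjugation_comp)
  qed
  \<comment> \<open>The weight balances the inner products of \<open>psi_K l x\<close> with
    \<open>ketbra x x\<close> and \<open>ketbra y y\<close>, which are \<open>sqrt (1 - l)\<close>
    and 1.\<close>
  define G where "G = ketbra x x - sqrt (1 - l) *\<^sub>R ketbra y y"
  have hs: "hs_inner (U ** A) (U ** B) = hs_inner A B" for A B
    by (simp add: hs_inner_mult_left matrix_mul_assoc UU)
  have isometry: "cinner (U *v a) (U *v b) = cinner a b" for a b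
    unfolding cinner_mult_vec_right[of _ U] matrix_vector_mul_assoc UU by simp
  have Kx: "psi_K l x *v x = sqrt (1 - l) *\<^sub>R x" "psi_K l x *v y = y"
    by (simp_all add: psi_K_def matrix_vector_mult_diff_rdistrib cmat_scaleR_mult_vec
        ketbra_mult_vec unit orth algebra_simps)
  have "cinner (sqrt (1 - l) *\<^sub>R x) x = of_real (sqrt (1 - l))"
    using cnj_cinner[of x "sqrt (1 - l) *\<^sub>R x"] by (simp add: cinner_scaleR_right unit)
  then have "hs_inner (psi_K l x) G = 0"
    by (simp add: G_def hs_inner_diff_right hs_inner_scaleR_right hs_inner_ketbra_right Kx unit)
  moreover have "hs_inner (psi_L l x y) G = 0"
    by (simp add: G_def hs_inner_diff_right hs_inner_scaleR_right hs_inner_ketbra_right psi_L_def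
        cmat_scaleR_mult_vec ketbra_mult_vec unit orth cinner_y_x cinner_eq_0_commute[of "_ *\<^sub>R _"]
        cinner_scaleR_right)
  ultimately have "U ** G \<in> hs_orthogonal (set ?Ks)" by (simp add: hs_orthogonal_def hs)
  then have "cinner ((U ** psi_K l x) *v x) ((U ** G) *v x) = 0"
    using assms unfolding image_condition_iff[OF k] ketbra_stable_def by simp
  also have "cinner ((U ** psi_K l x) *v x) ((U ** G) *v x) = cinner (psi_K l x *v x) (G *v x)"
    by (simp only: matrix_vector_mul_assoc[symmetric] isometry)
  also have "\<dots> = of_real (sqrt (1 - l))"
    using \<open>cinner (sqrt (1 - l) *\<^sub>R x) x = of_real (sqrt (1 - l))\<close>
    by (simp add: Kx G_def matrix_vector_mult_diff_rdistrib cmat_scaleR_mult_vec ketbra_mult_vec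
        unit cinner_y_x)
  finally show False using sqrt_one_minus_pos by simp
qed

text \<open>At \<open>B ** psi_K l x\<close> the first term of \<open>psi_inv\<close> loses its
  factor \<open>psi_K_inv\<close>. The second acquires \<open>sqrt (1 - l)\<close>, whose square
  removes the denominator of \<open>l / (1 - l)\<close>.\<close>

lemma choi_comp_psi_inv_form:
  assumes k: "kraus_ops \<Phi> Ks"
  shows "cinner (mvec (B ** psi_K l x)) (choi (\<Phi> \<circ> psi_inv l x y) *v mvec (B ** psi_K l x)) =
    of_real ((\<Sum>K\<leftarrow>Ks. (cmod (hs_inner K B))\<^sup>2) -
      l * (\<Sum>K\<leftarrow>Ks. (cmod (hs_inner (K ** ketbra y x) B))\<^sup>2))"
proof -
  let ?J = "psi_K_inv l x" and ?E = "ketbra y x" and ?w = "mvec (B ** psi_K l x)"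
  define F where "F A X = (\<Sum>K\<leftarrow>Ks. (K ** A) ** X ** dagger (K ** A))" for A X :: "'n cmat"
  have kF: "kraus_ops (F A) (map (\<lambda>K. K ** A) Ks)" for A
    by (simp add: kraus_ops_def F_def o_def)
  have F: "\<Phi> (A ** X ** dagger A) = F A X" for A X
    using k by (simp add: kraus_ops_def F_def conjugation_comp)
  have "choi (\<Phi> \<circ> psi_inv l x y) = choi (F ?J) - (l / (1 - l)) *\<^sub>R choi (F ?E)"
    using kraus_ops_clinear[OF k]
    by (simp add: vec_eq_iff choi_nth psi_inv_def clinear_diff clinear_scaleR F)
  moreover have "cinner w (choi (F A) *v w) =
      of_real (\<Sum>K\<leftarrow>Ks. (cmod (hs_inner (K ** A) (unvec w)))\<^sup>2)" for A w
    unfolding kraus_ops_choi[OF kF] sum_ketbra_form hs_inner_eq_cinner by (simp add: o_def)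
  moreover have "hs_inner (K ** ?J) (B ** psi_K l x) = hs_inner K B" for K
  proof -
    have "psi_K l x ** dagger ?J = dagger (?J ** psi_K l x)"
      by (simp add: dagger_mult dagger_psi_K)
    then show ?thesis
      by (simp add: hs_inner_mult_right psi_K_inv_psi_K flip: matrix_mul_assoc)
  qed
  moreover have "hs_inner (K ** ?E) (B ** psi_K l x) = of_real (sqrt (1 - l)) * hs_inner (K ** ?E) B"
    for K
  proof -
    have "psi_K l x ** dagger ?E = dagger (?E ** psi_K l x)"
      by (simp add: dagger_mult dagger_psi_K)
    then show ?thesis
      by (simp add: hs_inner_mult_right ketbra_psi_K dagger_scaleR cmat_scaleR_right
          hs_inner_scaleR_right flip: matrix_mul_assoc)
  qed
  ultimately show ?thesis
    using l by (simp add: matrix_vector_mult_diff_rdistrib cmat_scaleR_mult_vec cinner_diff_right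
        cinner_scaleR_right norm_mult power_mult_distrib sum_list_const_mult)
qed

lemma comp_psi_inv_kraus_ops:
  assumes k: "kraus_ops \<Phi> Ks"
    and le: "\<And>B. l * (\<Sum>K\<leftarrow>Ks. (cmod (hs_inner (K ** ketbra y x) B))\<^sup>2) \<le>
      (\<Sum>K\<leftarrow>Ks. (cmod (hs_inner K B))\<^sup>2)"
  shows "\<exists>Ls. kraus_ops (\<Phi> \<circ> psi_inv l x y) Ls"
proof (rule psd_choi_imp_kraus_ops)
  show "clinear (\<Phi> \<circ> psi_inv l x y)"
    by (intro clinear_comp kraus_ops_clinear[OF k] clinear_psi_inv)
  show "psd (choi (\<Phi> \<circ> psi_inv l x y))"
    unfolding psd_def
  proof
    fix w
    \<comment> \<open>Since \<open>psi_K\<close> is invertible, the form is known at every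
      vector.\<close>
    have "w = mvec (unvec w ** psi_K_inv l x ** psi_K l x)"
      by (simp add: psi_K_inv_psi_K flip: matrix_mul_assoc)
    then show "cinner w (choi (\<Phi> \<circ> psi_inv l x y) *v w) \<in> \<real>\<^sub>\<ge>\<^sub>0"
      using le choi_comp_psi_inv_form[OF k, of "unvec w ** psi_K_inv l x"]
      by (metis diff_ge_0_iff_ge nonneg_Reals_of_real_iff)
  qed
qed

text \<open>In the coordinates \<open>B ** psi_K l x\<close>, the kernel of the new Choi matrix
  contains all solutions of D = l N. These include every zero of \<open>D\<close>, hence the kernel
  of \<open>choi \<Phi>\<close>, and also \<open>B0\<close>, where \<open>D\<close> is
  positive.\<close>

lemma kraus_rank_comp_psi_inv_less:
  assumes k: "kraus_ops \<Phi> Ks"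
    and le: "\<And>B. l * (\<Sum>K\<leftarrow>Ks. (cmod (hs_inner (K ** ketbra y x) B))\<^sup>2) \<le>
      (\<Sum>K\<leftarrow>Ks. (cmod (hs_inner K B))\<^sup>2)"
    and pos: "0 < (\<Sum>K\<leftarrow>Ks. (cmod (hs_inner K B0))\<^sup>2)"
    and eq: "l * (\<Sum>K\<leftarrow>Ks. (cmod (hs_inner (K ** ketbra y x) B0))\<^sup>2) =
      (\<Sum>K\<leftarrow>Ks. (cmod (hs_inner K B0))\<^sup>2)"
  shows "kraus_rank (\<Phi> \<circ> psi_inv l x y) < kraus_rank \<Phi>"
proof -
  let ?R = "kron (transpose (psi_K l x)) (mat 1 :: 'n cmat)"
    and ?R' = "kron (transpose (psi_K_inv l x)) (mat 1 :: 'n cmat)"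
    and ?M = "choi (\<Phi> \<circ> psi_inv l x y)"
  define D where "D B = (\<Sum>K\<leftarrow>Ks. (cmod (hs_inner K B))\<^sup>2)" for B
  define N where "N B = (\<Sum>K\<leftarrow>Ks. (cmod (hs_inner (K ** ketbra y x) B))\<^sup>2)" for B
  have "(?R ** ?R') *v mvec B = mat 1 *v mvec B" for B
    by (simp add: kron_mult_mvec psi_K_inv_psi_K flip: matrix_vector_mul_assoc matrix_mul_assoc)
  then have "?R ** ?R' = mat 1" unfolding matrix_eq by (metis mvec_unvec)
  \<comment> \<open>This factorisation bounds the rank of \<open>?M\<close> by that of
    \<open>?M ** ?R\<close>.\<close>
  then have M: "?M = (?M ** ?R) ** ?R'" by (simp flip: matrix_mul_assoc)
  obtain Ls where Ls: "kraus_ops (\<Phi> \<circ> psi_inv l x y) Ls"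
    using comp_psi_inv_kraus_ops[OF k le] by blast
  have ker: "(?M ** ?R) *v mvec B = 0" if "D B = l * N B" for B
  proof -
    let ?w = "mvec (B ** psi_K l x)"
    \<comment> \<open>For a positive semidefinite matrix a zero of the form is a kernel vector; the
      Kraus operators \<open>Ls\<close> make this explicit.\<close>
    have "cinner ?w (?M *v ?w) = 0"
      unfolding choi_comp_psi_inv_form[OF k] using that by (simp add: D_def N_def)
    then have "(\<Sum>L\<leftarrow>Ls. (cmod (cinner (mvec L) ?w))\<^sup>2) = 0"
      unfolding kraus_ops_choi[OF Ls] sum_ketbra_form by (simp only: of_real_eq_0_iff)
    then have "?M *v ?w = 0"
      unfolding kraus_ops_choi[OF Ls] sum_ketbra_kernel by (simp only: sum_squares_eq_0_iff)
    then show ?thesis by (simp add: kron_mult_mvec flip: matrix_vector_mul_assoc)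
  qed
  have choi_ker: "choi \<Phi> *v mvec B = 0 \<longleftrightarrow> D B = 0" for B
    unfolding kraus_ops_choi[OF k] sum_ketbra_kernel D_def sum_squares_eq_0_iff hs_inner_eq_cinner
    by (rule refl)
  have "rank (?M ** ?R) < rank (choi \<Phi>)"
  proof (rule rank_less_if_kernel)
    fix w assume "choi \<Phi> *v w = 0"
    then have "D (unvec w) = 0" using choi_ker[of "unvec w"] by simp
    moreover have "0 \<le> N (unvec w)" unfolding N_def by (auto intro!: sum_list_nonneg)
    ultimately have "D (unvec w) = l * N (unvec w)"
      using le[of "unvec w"] l by (simp add: D_def N_def mult_le_0_iff)
    then show "(?M ** ?R) *v w = 0" using ker[of "unvec w"] by simp
  next
    show "choi \<Phi> *v mvec B0 \<noteq> 0" using pos unfolding choi_ker D_def by simp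
    show "(?M ** ?R) *v mvec B0 = 0" using eq by (intro ker) (simp add: D_def N_def)
  qed
  then show ?thesis
    unfolding kraus_rank_def using rank_mult_le_left[of "?M ** ?R" ?R'] M by simp
qed

end

text \<open>Otherwise \<open>\<Phi>(|x\<rangle>\<langle>x|) - \<Phi>(|y\<rangle>\<langle>y|)\<close> is positive semidefinite of trace zero.\<close>

lemma kraus_form_exceeds:
  fixes x y :: "complex^'n::finite"
  assumes channel: "\<Phi> \<in> CPTP" and k: "kraus_ops \<Phi> Ks"
    and unit: "cinner x x = 1" "cinner y y = 1" and neq: "\<Phi> (ketbra x x) \<noteq> \<Phi> (ketbra y y)"
  shows "\<exists>B. (\<Sum>K\<leftarrow>Ks. (cmod (hs_inner K B))\<^sup>2) <
    (\<Sum>K\<leftarrow>Ks. (cmod (hs_inner (K ** ketbra y x) B))\<^sup>2)"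
proof (rule ccontr)
  assume "\<not> ?thesis"
  then have le: "(\<Sum>K\<leftarrow>Ks. (cmod (hs_inner (K ** ketbra y x) B))\<^sup>2) \<le>
    (\<Sum>K\<leftarrow>Ks. (cmod (hs_inner K B))\<^sup>2)" for B
    by (simp add: not_less)
  define H where "H = \<Phi> (ketbra x x) - \<Phi> (ketbra y y)"
  have "cinner u (H *v u) \<in> \<real>\<^sub>\<ge>\<^sub>0" for u
  proof -
    have "cinner u (H *v u) = of_real ((\<Sum>K\<leftarrow>Ks. (cmod (cinner (K *v x) u))\<^sup>2) -
        (\<Sum>K\<leftarrow>Ks. (cmod (cinner (K *v y) u))\<^sup>2))"
      unfolding H_def kraus_ops_ketbra[OF k] matrix_vector_mult_diff_rdistrib cinner_diff_right
        sum_ketbra_form by simp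
    moreover have "(\<Sum>K\<leftarrow>Ks. (cmod (cinner (K *v y) u))\<^sup>2) \<le>
        (\<Sum>K\<leftarrow>Ks. (cmod (cinner (K *v x) u))\<^sup>2)"
      \<comment> \<open>At \<open>ketbra u x\<close> the two sides become the forms at
        \<open>u\<close> of the images of \<open>ketbra y y\<close> and
        \<open>ketbra x x\<close>.\<close>
      using le[of "ketbra u x", unfolded hs_inner_mult_ketbra]
      by (simp only: hs_inner_ketbra_right ketbra_mult_vec unit vector_smult_lid)
    ultimately show ?thesis by (simp only: nonneg_Reals_of_real_iff diff_ge_0_iff_ge)
  qed
  then have "psd H" by (simp add: psd_def)
  then obtain vs where vs: "H = (\<Sum>v\<leftarrow>vs. ketbra v v)" using psd_decomposition by blast
  \<comment> \<open>Both images have trace one; on the other hand the trace of \<open>H\<close> is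
    the sum of the squared norms of \<open>vs\<close>.\<close>
  have "trace H = 0"
    using channel by (simp add: H_def trace_cmat_diff CPTP_def trace_ketbra unit)
  then have "of_real (\<Sum>v\<leftarrow>vs. (norm v)\<^sup>2) = (0 :: complex)"
    unfolding vs trace_sum_list trace_ketbra cinner_self by (simp add: sum_list_of_real[symmetric] o_def)
  then have "(\<Sum>v\<leftarrow>vs. (norm v)\<^sup>2) = 0" by (simp only: of_real_eq_0_iff)
  then have "\<forall>v\<in>set vs. v = 0"
    by (subst (asm) sum_list_nonneg_eq_0_iff) auto
  then have "H = 0" unfolding vs by (induction vs) (simp_all add: ketbra_def vec_eq_iff)
  then show False using neq by (simp add: H_def)
qed

section \<open>Choosing the parameter of the division\<close>

lemma ketbra_stable_imp_kernel:
  assumes "ketbra_stable Ks x y" and D0: "(\<Sum>K\<leftarrow>Ks. (cmod (hs_inner K B))\<^sup>2) = 0"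
  shows "(\<Sum>K\<leftarrow>Ks. (cmod (hs_inner (K ** ketbra y x) B))\<^sup>2) = 0"
proof -
  have "B \<in> hs_orthogonal (set Ks)"
    using D0 unfolding sum_squares_eq_0_iff by (simp add: hs_orthogonal_def)
  then show ?thesis
    using assms(1) unfolding ketbra_stable_def sum_squares_eq_0_iff hs_inner_mult_ketbra by blast
qed

text \<open>The inverse inherits trace preservation from \<open>psi\<close>, since every
  \<open>X\<close> equals \<open>psi\<close> applied to \<open>psi_inv\<close> of
  \<open>X\<close>.\<close>

lemma comp_psi_inv_CPTP:
  fixes x y :: "complex^'n::finite"
  assumes xy: "cinner x x = 1" "cinner y y = 1" "cinner x y = 0" "0 < l" "l < 1"
    and channel: "\<Phi> \<in> CPTP" and kraus: "kraus_ops (\<Phi> \<circ> psi_inv l x y) Ls"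
  shows "\<Phi> \<circ> psi_inv l x y \<in> CPTP"
proof -
  have "trace (psi_inv l x y X) = trace X" for X
    using psi_CPTP[OF xy] psi_psi_inv[OF xy, of X] by (metis (mono_tags, lifting) CPTP_def mem_Collect_eq)
  then show ?thesis
    using channel kraus_ops_imp_completely_positive[OF kraus] by (simp add: CPTP_def)
qed

lemma image_condition_division:
  fixes \<Phi> :: "'n::finite cmat \<Rightarrow> 'n cmat" and x y :: "complex^'n"
  assumes channel: "\<Phi> \<in> CPTP"
    and xy: "cinner x x = 1" "cinner y y = 1" "cinner x y = 0"
    and cond: "image_condition \<Phi> x y"
  shows "\<exists>l. 0 < l \<and> l < 1 \<and> completely_positive (\<Phi> \<circ> inv (psi l x y)) \<and>
      channel_division \<Phi> (\<Phi> \<circ> inv (psi l x y)) (psi l x y)"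
    and "\<Phi> (ketbra x x) \<noteq> \<Phi> (ketbra y y) \<Longrightarrow> \<exists>l. 0 < l \<and> l < 1 \<and>
      completely_positive (\<Phi> \<circ> inv (psi l x y)) \<and>
      kraus_rank (\<Phi> \<circ> inv (psi l x y)) < kraus_rank \<Phi>"
proof -
  obtain Ks where k: "kraus_ops \<Phi> Ks"
    using channel completely_positive_imp_kraus_ops by (auto simp: CPTP_def)
  define D where "D B = (\<Sum>K\<leftarrow>Ks. (cmod (hs_inner K B))\<^sup>2)" for B
  define N where "N B = (\<Sum>K\<leftarrow>Ks. (cmod (hs_inner (K ** ketbra y x) B))\<^sup>2)" for B
  have D0: "0 \<le> D B" and N0: "0 \<le> N B" for B
    unfolding D_def N_def by (auto intro!: sum_list_nonneg)
  have ker: "D B = 0 \<Longrightarrow> N B = 0" for B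
    unfolding D_def N_def
    using cond[unfolded image_condition_iff[OF k]] by (intro ketbra_stable_imp_kernel) simp_all
  have "\<exists>C\<ge>0. (\<forall>B. N B \<le> C * D B) \<and>
      (\<forall>B. N B > 0 \<longrightarrow> (\<exists>B0. D B0 > 0 \<and> N B0 = C * D B0))"
    by (rule sum_squares_domination[of hs_inner "\<lambda>K. hs_inner (K ** ketbra y x)" Ks,
          OF linear_hs_inner linear_hs_inner, folded D_def N_def]) (erule ker)
  then obtain C where C: "C \<ge> 0" "\<And>B. N B \<le> C * D B"
    "\<And>B. N B > 0 \<Longrightarrow> \<exists>B0. D B0 > 0 \<and> N B0 = C * D B0"
    by blast
  {
    \<comment> \<open>Adding 2 ensures \<open>l\<close> < 1 for every \<open>C\<close>, including
      \<open>C\<close> = 0, and keeps \<open>l * C\<close> below 1.\<close>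
    define l where "l = 1 / (C + 2)"
    have l: "0 < l" "l < 1" using C(1) by (simp_all add: l_def)
    have "l * N B \<le> D B" for B
    proof -
      have "N B \<le> (C + 2) * D B" using C(2)[of B] D0[of B] by (simp add: algebra_simps)
      then show ?thesis using C(1) by (simp add: l_def divide_le_eq mult.commute)
    qed
    then obtain Ls where Ls: "kraus_ops (\<Phi> \<circ> psi_inv l x y) Ls"
      using comp_psi_inv_kraus_ops[OF xy l k] by (auto simp: D_def N_def)
    have "\<Phi> = \<Phi> \<circ> psi_inv l x y \<circ> psi l x y"
      using psi_inv_psi[OF xy l] by (simp add: fun_eq_iff)
    \<comment> \<open>Neither factor is unitary, so the equivalence in
      \<open>channel_division\<close> holds.\<close>
    then have "channel_division \<Phi> (\<Phi> \<circ> psi_inv l x y) (psi l x y)"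
      unfolding channel_division_def
      using comp_psi_inv_CPTP[OF xy l channel Ls] psi_CPTP[OF xy l] psi_not_unitary[OF xy l]
        image_condition_not_unitary[OF xy l cond] by blast
    then show "\<exists>l. 0 < l \<and> l < 1 \<and> completely_positive (\<Phi> \<circ> inv (psi l x y)) \<and>
        channel_division \<Phi> (\<Phi> \<circ> inv (psi l x y)) (psi l x y)"
      using l kraus_ops_imp_completely_positive[OF Ls] inv_psi[OF xy l] by metis
  }
  {
    assume neq: "\<Phi> (ketbra x x) \<noteq> \<Phi> (ketbra y y)"
    obtain B where B: "D B < N B"
      using kraus_form_exceeds[OF channel k xy(1,2) neq] by (auto simp: D_def N_def)
    then obtain B0 where B0: "D B0 > 0" "N B0 = C * D B0" using C(3)[of B] D0[of B] by force
    have "C > 1"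
    proof (rule ccontr)
      assume "\<not> C > 1"
      then have "C * D B \<le> 1 * D B" by (intro mult_right_mono D0) simp
      then show False using B C(2)[of B] by simp
    qed
    \<comment> \<open>The largest value for which \<open>C\<close> gives \<open>le\<close>; the
      bound becomes an equality at \<open>B0\<close>, which provides the additional kernel
      vector.\<close>
    define l where "l = 1 / C"
    have l: "0 < l" "l < 1" using \<open>C > 1\<close> by (simp_all add: l_def)
    have le: "l * N B \<le> D B" for B
      using C(2)[of B] \<open>C > 1\<close> by (simp add: l_def divide_le_eq mult.commute)
    have eq: "l * N B0 = D B0" using B0 \<open>C > 1\<close> by (simp add: l_def)
    obtain Ls where Ls: "kraus_ops (\<Phi> \<circ> psi_inv l x y) Ls"
      using comp_psi_inv_kraus_ops[OF xy l k] le by (auto simp: D_def N_def)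
    have "kraus_rank (\<Phi> \<circ> psi_inv l x y) < kraus_rank \<Phi>"
      using kraus_rank_comp_psi_inv_less[OF xy l k] le eq B0(1) by (simp add: D_def N_def)
    then show "\<exists>l. 0 < l \<and> l < 1 \<and> completely_positive (\<Phi> \<circ> inv (psi l x y)) \<and>
        kraus_rank (\<Phi> \<circ> inv (psi l x y)) < kraus_rank \<Phi>"
      using l kraus_ops_imp_completely_positive[OF Ls] inv_psi[OF xy l] by metis
  }
qed

theorem theorem1:
  fixes \<Phi> :: "'n::finite cmat \<Rightarrow> 'n cmat" and x x' :: "complex^'n"
  assumes channel: "\<Phi> \<in> CPTP"
    and unit: "norm x = 1" "norm x' = 1"
    and orthogonal: "cinner x x' = 0"
  shows "(image_condition \<Phi> x x' \<longleftrightarrow>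
            (\<forall>Ks B. kraus_ops \<Phi> Ks \<and> is_cmat_basis B (hs_orthogonal (kraus_subspace \<Phi>)) \<longrightarrow>
              kraus_condition Ks B x x')) \<and>
         (image_condition \<Phi> x x' \<longleftrightarrow>
            (\<exists>Ks B. kraus_ops \<Phi> Ks \<and> is_cmat_basis B (hs_orthogonal (kraus_subspace \<Phi>)) \<and>
              kraus_condition Ks B x x')) \<and>
         (image_condition \<Phi> x x' \<longrightarrow>
            (\<exists>l. 0 < l \<and> l < 1 \<and>
              completely_positive (\<Phi> \<circ> inv (psi l x x')) \<and>
              channel_division \<Phi> (\<Phi> \<circ> inv (psi l x x')) (psi l x x')) \<and>
            divisible \<Phi>) \<and>
         (image_condition \<Phi> x x' \<and> \<Phi> (ketbra x x) \<noteq> \<Phi> (ketbra x' x') \<longrightarrow>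
            (\<exists>l. 0 < l \<and> l < 1 \<and>
              completely_positive (\<Phi> \<circ> inv (psi l x x')) \<and>
              kraus_rank (\<Phi> \<circ> inv (psi l x x')) < kraus_rank \<Phi>))"
proof -
  have xy: "cinner x x = 1" "cinner x' x' = 1" "cinner x x' = 0"
    using unit orthogonal by (simp_all add: cinner_self)
  have iff: "kraus_condition Ks B x x' \<longleftrightarrow> image_condition \<Phi> x x'"
    if "kraus_ops \<Phi> Ks" "is_cmat_basis B (hs_orthogonal (kraus_subspace \<Phi>))" for Ks B
    using kraus_condition_iff[OF that] image_condition_iff[OF that(1)] by blast
  \<comment> \<open>Existence of a Kraus family and a basis lets the universal form of (ii) imply
    (i), and lets (i) imply the existential form.\<close>
  obtain Ks B where "kraus_ops \<Phi> Ks" "is_cmat_basis B (hs_orthogonal (kraus_subspace \<Phi>))"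
    using channel completely_positive_imp_kraus_ops cmat_basis_exists[OF subspace_hs_orthogonal]
    by (metis (no_types, lifting) CPTP_def mem_Collect_eq)
  then show ?thesis
    using iff image_condition_division[OF channel xy] channel unfolding divisible_def by metis
qed

end
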